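(* In the wavelet/Fourier setting described in the context, for $N\in\mathbb{N}$ let $G_N:\mathcal{H}\to\mathcal{T}_N$ be a sequence of perfect reconstruction methods with sampling ratio $\eta_G\ge 1$. If $\eta_G<\frac{1}{\epsilon\lceil a\rceil}$, then $\kappa(G_N)$ is unbounded (as $N$ varies) and $\kappa(G_{N_R})$ becomes exponentially large as $N_R\to\infty$, that is, there exist constants $K,\rho>0$ such that $\kappa(G_{N_R})\ge K e^{\rho N_R}$ for all sufficiently large $R\in\mathbb{N}$.
   Context: $\mathbb{N}=\{1,2,\dots\}$, $\mathbb{Z}_+=\{0,1,2,\dots\}$. Work in $\mathcal{H}=L^2(\mathbb{R})$ with its usual inner product $\langle\cdot,\cdot\rangle$ and norm $\|\cdot\|$. Wavelets: $\phi$ is a scaling function generating a multiresolution analysis (MRA): closed subspaces $V_j\subset V_{j+1}$ ($j\in\mathbb{Z}$) of $L^2(\mathbb{R})$ with $f\in V_j\iff f(2\cdot)\in V_{j+1}$, $\bigcap_j V_j=\{0\}$, $\overline{\bigcup_j V_j}=L^2(\mathbb{R})$, and $\{\phi(\cdot-k):k\in\mathbb{Z}\}$ an orthonormal basis of $V_0$; $\psi$ is an associated wavelet (so $\{\psi(\cdot-k):k\in\mathbb{Z}\}$ is an orthonormal basis of the orthogonal complement of $V_0$ in $V_1$). It is assumed that $\mathrm{supp}(\phi)=\mathrm{supp}(\psi)=[0,a]$ with $a\ge 1$. Write $\phi_{j,k}=2^{j/2}\phi(2^j\cdot-k)$, $\psi_{j,k}=2^{j/2}\psi(2^j\cdot-k)$.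 Reconstruction space: $\Omega_a=\{\phi_{0,k}: |k|\le\lceil a\rceil-1\}\cup\{\psi_{j,k}: j\in\mathbb{Z}_+,\,-\lceil a\rceil+1\le k\le 2^j\lceil a\rceil-1\}$, enumerated as $\{\varphi_j\}_{j\in\mathbb{N}}$ by listing first the $\phi_{0,k}$ in increasing order of $k$, then the $\psi_{0,k}$ in increasing order of $k$, then the $\psi_{1,k}$ in increasing order of $k$, and so on. $\mathcal{T}=\overline{\mathrm{span}}\,\Omega_a$, $\mathcal{T}_N=\mathrm{span}\{\varphi_1,\dots,\varphi_N\}$. For $R\in\mathbb{N}$, $N_R=2^R\lceil a\rceil+(R+1)(\lceil a\rceil-1)$. Sampling: $T_1\ge\lceil a\rceil-1$ and $T_2\ge 2\lceil a\rceil-1$ are fixed, so that $\mathcal{T}\subset L^2[-T_1,T_2]$. The sampling density satisfies $0<\epsilon\le 1/(T_1+T_2)$, and for $l\in\mathbb{Z}$, $$s_l^\epsilon=\sqrt{\epsilon}\,e^{2\pi i l\epsilon\,\cdot}\,\chi_{[-T_1/(\epsilon(T_1+T_2)),\,T_2/(\epsilon(T_1+T_2))]}.$$ The first $M$ samples of $f\in\mathcal{H}$ are $\hat f^{[M]}=(\langle f,s_l^\epsilon\rangle)_{-\lfloor M/2\rfloor\le l\le\lceil M/2\rceil-1}\in\mathbb{C}^M$. Methods: for each $N$, $G_N$ is a mapping $\mathcal{H}\to\mathcal{T}_N$ such that $G_N(f)$ depends only on the first $M=\Theta_G(N)$ samples $\hat f^{[M]}$ of $f$, where $\Theta_G(N)\in\mathbb{N}$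 and $\Theta_G(N)\ge N$. It is perfect if $G_N(f)=f$ for all $f\in\mathcal{T}_N$. Its sampling ratio is $\eta_G=\limsup_{N\to\infty}\Theta_G(N)/N$, assumed finite. Its condition number is, with $M=\Theta_G(N)$, $$\kappa(G_N)=\sup_{f\in\mathcal{H}}\ \lim_{t\to0^+}\ \sup_{g\in\mathcal{H},\ 0<\|\hat g^{[M]}\|_{\ell^2}\le t}\frac{\|G_N(f+g)-G_N(f)\|}{\|\hat g^{[M]}\|_{\ell^2}} .$$ *)

theory Defs
  imports "HOL-Analysis.Analysis"
begin

section \<open>The Hilbert space $L^2(\mathbb{R})$ of complex-valued functions\<close>

definition square_integrable :: "(real \<Rightarrow> complex) \<Rightarrow> bool" where
  "square_integrable f \<longleftrightarrow>
     f \<in> borel_measurable lborel \<and> integrable lborel (\<lambda>x. (cmod (f x))\<^sup>2)"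

definition L2_eq :: "(real \<Rightarrow> complex) \<Rightarrow> (real \<Rightarrow> complex) \<Rightarrow> bool" where
  "L2_eq f g \<longleftrightarrow> square_integrable f \<and> square_integrable g \<and> (AE x in lborel. f x = g x)"

lemma L2_eqI:
  "square_integrable f \<Longrightarrow> square_integrable g \<Longrightarrow> AE x in lborel. f x = g x \<Longrightarrow> L2_eq f g"
  by (simp add: L2_eq_def)

lemma L2_eqD:
  assumes "L2_eq f g"
  shows "square_integrable f" "square_integrable g" "AE x in lborel. f x = g x"
  using assms by (simp_all add: L2_eq_def)

lemma square_integrable_measurable:
  "square_integrable f \<Longrightarrow> f \<in> borel_measurable borel"
  by (simp add: square_integrable_def)

lemma cnj_measurable [measurable]: "cnj \<in> borel_measurable borel"
  by (intro borel_measurable_continuous_onI continuous_intros)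

lemma square_integrable_zero: "square_integrable (\<lambda>x. 0)"
  by (simp add: square_integrable_def)

lemma square_integrable_mult:
  assumes "square_integrable f"
  shows "square_integrable (\<lambda>x. c * f x)"
proof -
  have [measurable]: "f \<in> borel_measurable borel"
    using assms by (rule square_integrable_measurable)
  show ?thesis
    using assms by (simp add: square_integrable_def norm_mult power_mult_distrib)
qed

lemma square_integrable_add:
  assumes "square_integrable f" "square_integrable g"
  shows "square_integrable (\<lambda>x. f x + g x)"
proof -
  have [measurable]: "f \<in> borel_measurable borel" "g \<in> borel_measurable borel"
    using assms by (simp_all add: square_integrable_measurable)
  have int: "integrable lborel (\<lambda>x. 2 * (cmod (f x))\<^sup>2 + 2 * (cmod (g x))\<^sup>2)"
    using assms by (simp add: square_integrable_def)
  have "(cmod (f x + g x))\<^sup>2 \<le> 2 * (cmod (f x))\<^sup>2 + 2 * (cmod (g x))\<^sup>2" for x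
  proof -
    have "(cmod (f x + g x))\<^sup>2 \<le> (cmod (f x) + cmod (g x))\<^sup>2"
      by (intro power_mono norm_triangle_ineq) simp
    also have "\<dots> \<le> 2 * (cmod (f x))\<^sup>2 + 2 * (cmod (g x))\<^sup>2"
      using sum_squares_bound[of "cmod (f x)" "cmod (g x)"] by (simp add: power2_sum)
    finally show ?thesis .
  qed
  then have bound: "AE x in lborel. norm ((cmod (f x + g x))\<^sup>2) \<le>
      norm (2 * (cmod (f x))\<^sup>2 + 2 * (cmod (g x))\<^sup>2)"
    by (intro AE_I2) simp
  have "integrable lborel (\<lambda>x. (cmod (f x + g x))\<^sup>2)"
    by (rule Bochner_Integration.integrable_bound[OF int _ bound]) measurable
  then show ?thesis
    by (simp add: square_integrable_def)
qed

lemma integrable_mult_cnj: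
  assumes "square_integrable f" "square_integrable g"
  shows "integrable lborel (\<lambda>x. f x * cnj (g x))"
proof -
  have [measurable]: "f \<in> borel_measurable borel" "g \<in> borel_measurable borel"
    using assms by (simp_all add: square_integrable_measurable)
  have int: "integrable lborel (\<lambda>x. (cmod (f x))\<^sup>2 + (cmod (g x))\<^sup>2)"
    using assms by (simp add: square_integrable_def)
  have "norm (f x * cnj (g x)) \<le> norm ((cmod (f x))\<^sup>2 + (cmod (g x))\<^sup>2)" for x
    using sum_squares_bound[of "cmod (f x)" "cmod (g x)"] mult_nonneg_nonneg[of "cmod (f x)" "cmod (g x)"]
    by (simp add: norm_mult del: mult_nonneg_nonneg)
  then have bound: "AE x in lborel. norm (f x * cnj (g x)) \<le> norm ((cmod (f x))\<^sup>2 + (cmod (g x))\<^sup>2)"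
    by (intro AE_I2)
  show ?thesis
    by (rule Bochner_Integration.integrable_bound[OF int _ bound]) measurable
qed

lemma square_integrable_affine:
  assumes "square_integrable f" "c \<noteq> 0"
  shows "square_integrable (\<lambda>x. f (c * x - t))"
proof -
  have [measurable]: "f \<in> borel_measurable borel"
    using assms(1) by (rule square_integrable_measurable)
  show ?thesis
    using assms lborel_integrable_real_affine[of "\<lambda>x. (cmod (f x))\<^sup>2" c "- t"]
    by (simp add: square_integrable_def)
qed

lemma L2_eq_affine:
  assumes "L2_eq f g" "c \<noteq> 0"
  shows "L2_eq (\<lambda>x. f (c * x - t)) (\<lambda>x. g (c * x - t))"
proof -
  note d = L2_eqD[OF assms(1)]
  have [measurable]: "f \<in> borel_measurable borel" "g \<in> borel_measurable borel"
    using d by (simp_all add: square_integrable_measurable)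
  have "AE x in lborel. f (c * x - t) = g (c * x - t)"
    using AE_borel_affine[of c "\<lambda>x. f x = g x" "- t"] d(3) assms(2) by simp
  then show ?thesis
    using d assms(2) by (simp add: L2_eqI square_integrable_affine)
qed

quotient_type L2 = "real \<Rightarrow> complex" / partial: L2_eq
proof (rule part_equivpI)
  show "\<exists>f. L2_eq f f"
    using square_integrable_zero by (auto simp: L2_eq_def)
  show "symp L2_eq"
    by (auto simp: symp_def L2_eq_def)
  show "transp L2_eq"
    by (auto simp: transp_def L2_eq_def elim: AE_mp)
qed

lift_definition cinner :: "L2 \<Rightarrow> L2 \<Rightarrow> complex" is
  "\<lambda>f g. \<integral>x. f x * cnj (g x) \<partial>lborel"
proof -
  fix f f' g g' :: "real \<Rightarrow> complex"
  assume f: "L2_eq f f'" and g: "L2_eq g g'"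
  have [measurable]: "f \<in> borel_measurable borel" "g \<in> borel_measurable borel"
    "f' \<in> borel_measurable borel" "g' \<in> borel_measurable borel"
    using L2_eqD[OF f] L2_eqD[OF g] by (simp_all add: square_integrable_measurable)
  show "(\<integral>x. f x * cnj (g x) \<partial>lborel) = (\<integral>x. f' x * cnj (g' x) \<partial>lborel)"
    using L2_eqD(3)[OF f] L2_eqD(3)[OF g] by (intro integral_cong_AE) auto
qed

lift_definition scaleC :: "complex \<Rightarrow> L2 \<Rightarrow> L2" is "\<lambda>c f x. c * f x"
  by (auto simp: L2_eq_def square_integrable_mult)

text \<open>
  The real inner product is \<open>Re \<langle>f, g\<rangle>\<close>; it induces the usual norm and makes
  \<^const>\<open>closure\<close> and \<^const>\<open>closed\<close> of the library available on \<open>L2\<close>.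
\<close>

instantiation L2 :: real_inner
begin

lift_definition zero_L2 :: L2 is "\<lambda>x. 0"
  by (simp add: L2_eq_def square_integrable_zero)

lift_definition plus_L2 :: "L2 \<Rightarrow> L2 \<Rightarrow> L2" is "\<lambda>f g x. f x + g x"
  by (auto simp: L2_eq_def square_integrable_add)

definition uminus_L2 :: "L2 \<Rightarrow> L2" where
  "- f = scaleC (- 1) f" for f :: L2

definition minus_L2 :: "L2 \<Rightarrow> L2 \<Rightarrow> L2" where
  "f - g = f + (- g)" for f g :: L2

definition scaleR_L2 :: "real \<Rightarrow> L2 \<Rightarrow> L2" where
  "r *\<^sub>R f = scaleC (complex_of_real r) f" for f :: L2

definition inner_L2 :: "L2 \<Rightarrow> L2 \<Rightarrow> real" where
  "inner f g = Re (cinner f g)" for f g :: L2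

lift_definition norm_L2 :: "L2 \<Rightarrow> real" is
  "\<lambda>f. sqrt (\<integral>x. (cmod (f x))\<^sup>2 \<partial>lborel)"
proof -
  fix f g :: "real \<Rightarrow> complex"
  assume f: "L2_eq f g"
  have [measurable]: "f \<in> borel_measurable borel" "g \<in> borel_measurable borel"
    using L2_eqD[OF f] by (simp_all add: square_integrable_measurable)
  show "sqrt (\<integral>x. (cmod (f x))\<^sup>2 \<partial>lborel) = sqrt (\<integral>x. (cmod (g x))\<^sup>2 \<partial>lborel)"
    using L2_eqD(3)[OF f] by (intro arg_cong[where f = sqrt] integral_cong_AE) auto
qed

definition sgn_L2 :: "L2 \<Rightarrow> L2" where
  "sgn f = scaleC (complex_of_real (inverse (norm f))) f" for f :: L2

definition dist_L2 :: "L2 \<Rightarrow> L2 \<Rightarrow> real" where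
  "dist f g = norm (f - g)" for f g :: L2

definition uniformity_L2 :: "(L2 \<times> L2) filter" where
  "uniformity_L2 = (INF e\<in>{0 <..}. principal {(f, g). dist f g < e})"

definition open_L2 :: "L2 set \<Rightarrow> bool" where
  "open_L2 U = (\<forall>f\<in>U. eventually (\<lambda>(f', g). f' = f \<longrightarrow> g \<in> U) uniformity)"

instance
proof
  fix f g h :: L2 and r s :: real
  show "f + g + h = f + (g + h)"
    by transfer (auto simp: L2_eq_def add.assoc intro!: square_integrable_add)
  show "f + g = g + f"
    by transfer (auto simp: L2_eq_def add.commute intro!: square_integrable_add)
  show "0 + f = f"
    by transfer (auto simp: L2_eq_def)
  show "- f + f = 0"
    unfolding uminus_L2_def
    by transfer (auto simp: L2_eq_def square_integrable_zero)
  show "f - g = f + - g"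
    by (rule minus_L2_def)
  show "r *\<^sub>R (f + g) = r *\<^sub>R f + r *\<^sub>R g"
    unfolding scaleR_L2_def
    by transfer (auto simp: L2_eq_def distrib_left intro!: square_integrable_add square_integrable_mult)
  show "(r + s) *\<^sub>R f = r *\<^sub>R f + s *\<^sub>R f"
    unfolding scaleR_L2_def
    by transfer (auto simp: L2_eq_def distrib_right intro!: square_integrable_add square_integrable_mult)
  show "r *\<^sub>R s *\<^sub>R f = (r * s) *\<^sub>R f"
    unfolding scaleR_L2_def
    by transfer (auto simp: L2_eq_def mult.assoc intro!: square_integrable_mult)
  show "1 *\<^sub>R f = f"
    unfolding scaleR_L2_def
    by transfer (auto simp: L2_eq_def)
  show "sgn f = inverse (norm f) *\<^sub>R f"
    by (simp only: sgn_L2_def scaleR_L2_def)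
  show "dist f g = norm (f - g)"
    by (rule dist_L2_def)
  show "uniformity = (INF e\<in>{0 <..}. principal {(f :: L2, g). dist f g < e})"
    by (rule uniformity_L2_def)
  show "open U = (\<forall>f\<in>U. eventually (\<lambda>(f', g). f' = f \<longrightarrow> g \<in> U) uniformity)" for U :: "L2 set"
    by (rule open_L2_def)
  have sq: "Re (z * cnj z) = (cmod z)\<^sup>2" for z
    by (simp add: complex_norm_square[symmetric] flip: of_real_power)
  show "inner f g = inner g f"
    unfolding inner_L2_def
  proof transfer
    fix f g :: "real \<Rightarrow> complex"
    have "cnj (\<integral>x. f x * cnj (g x) \<partial>lborel) = (\<integral>x. g x * cnj (f x) \<partial>lborel)"
      by (subst Bochner_Integration.integral_cnj[symmetric]) (simp add: mult.commute)
    then show "Re (\<integral>x. f x * cnj (g x) \<partial>lborel) = Re (\<integral>x. g x * cnj (f x) \<partial>lborel)"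
      by (metis cnj.simps(1))
  qed
  show "inner (f + g) h = inner f h + inner g h"
    unfolding inner_L2_def
    by transfer (simp add: L2_eq_def integrable_mult_cnj distrib_right)
  show "inner (r *\<^sub>R f) g = r * inner f g"
    unfolding inner_L2_def scaleR_L2_def
    by transfer (simp add: mult.assoc)
  have inner_self: "inner f f = (norm f)\<^sup>2"
    unfolding inner_L2_def
  proof transfer
    fix f :: "real \<Rightarrow> complex"
    assume "L2_eq f f"
    then have "Re (\<integral>x. f x * cnj (f x) \<partial>lborel) = (\<integral>x. (cmod (f x))\<^sup>2 \<partial>lborel)"
      by (subst integral_Re[symmetric]) (simp_all only: sq integrable_mult_cnj L2_eqD)
    then show "Re (\<integral>x. f x * cnj (f x) \<partial>lborel) = (sqrt (\<integral>x. (cmod (f x))\<^sup>2 \<partial>lborel))\<^sup>2"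
      by simp
  qed
  have norm_nonneg: "norm f \<ge> 0"
    by transfer simp
  show "inner f f \<ge> 0"
    by (simp add: inner_self)
  show "norm f = sqrt (inner f f)"
    using norm_nonneg by (simp add: inner_self)
  have "norm f = 0 \<longleftrightarrow> f = 0"
  proof transfer
    fix f :: "real \<Rightarrow> complex"
    assume "L2_eq f f"
    then have f: "square_integrable f"
      by (rule L2_eqD)
    then have "integrable lborel (\<lambda>x. (cmod (f x))\<^sup>2)"
      by (simp add: square_integrable_def)
    then show "sqrt (\<integral>x. (cmod (f x))\<^sup>2 \<partial>lborel) = 0 \<longleftrightarrow> L2_eq f (\<lambda>x. 0)"
      using f by (simp add: integral_nonneg_eq_0_iff_AE L2_eq_def square_integrable_zero)
  qed
  then show "inner f f = 0 \<longleftrightarrow> f = 0"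
    by (simp add: inner_self)
qed

end

interpretation L2: vector_space scaleC
proof
  fix c d :: complex and f g :: L2
  show "scaleC c (f + g) = scaleC c f + scaleC c g"
    by transfer (auto simp: L2_eq_def distrib_left intro!: square_integrable_add square_integrable_mult)
  show "scaleC (c + d) f = scaleC c f + scaleC d f"
    by transfer (auto simp: L2_eq_def distrib_right intro!: square_integrable_add square_integrable_mult)
  show "scaleC c (scaleC d f) = scaleC (c * d) f"
    by transfer (auto simp: L2_eq_def mult.assoc intro!: square_integrable_mult)
  show "scaleC 1 f = f"
    by transfer (auto simp: L2_eq_def)
qed

text \<open>
  The support of an \<open>L2\<close> class: the complement of the largest open set on which it vanishes
  almost everywhere.
\<close>

lift_definition ess_support :: "L2 \<Rightarrow> real set" is
  "\<lambda>f. - \<Union>{U. open U \<and> (AE x in lborel. x \<in> U \<longrightarrow> f x = 0)}"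
proof -
  fix f g :: "real \<Rightarrow> complex"
  assume "L2_eq f g"
  then have "AE x in lborel. f x = g x"
    by (rule L2_eqD)
  then have "(AE x in lborel. x \<in> U \<longrightarrow> f x = 0) \<longleftrightarrow> (AE x in lborel. x \<in> U \<longrightarrow> g x = 0)" for U
    by (auto elim!: AE_mp)
  then show "- \<Union>{U. open U \<and> (AE x in lborel. x \<in> U \<longrightarrow> f x = 0)} =
      - \<Union>{U. open U \<and> (AE x in lborel. x \<in> U \<longrightarrow> g x = 0)}"
    by simp
qed


section \<open>Multiresolution analyses and wavelets\<close>

text \<open>\<open>dyadic j k f = 2 powr (j / 2) * f (2 ^ j * _ - k)\<close>, written $f_{j,k}$ in the literature.\<close>

lift_definition dyadic :: "int \<Rightarrow> int \<Rightarrow> L2 \<Rightarrow> L2" is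
  "\<lambda>j k f x. complex_of_real (2 powr (real_of_int j / 2)) * f (2 powr real_of_int j * x - real_of_int k)"
proof -
  fix j k :: int and f g :: "real \<Rightarrow> complex"
  assume "L2_eq f g"
  then have "L2_eq (\<lambda>x. f (2 powr real_of_int j * x - real_of_int k))
      (\<lambda>x. g (2 powr real_of_int j * x - real_of_int k))"
    by (rule L2_eq_affine) simp
  then show "L2_eq
      (\<lambda>x. complex_of_real (2 powr (real_of_int j / 2)) * f (2 powr real_of_int j * x - real_of_int k))
      (\<lambda>x. complex_of_real (2 powr (real_of_int j / 2)) * g (2 powr real_of_int j * x - real_of_int k))"
    by (auto simp: L2_eq_def square_integrable_mult)
qed

lift_definition dilate2 :: "L2 \<Rightarrow> L2" is "\<lambda>f x. f (2 * x)"
  using L2_eq_affine[where c = 2 and t = 0] by simp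

definition orthonormal_basis :: "('i \<Rightarrow> L2) \<Rightarrow> L2 set \<Rightarrow> bool" where
  "orthonormal_basis e S \<longleftrightarrow>
     (\<forall>i k. cinner (e i) (e k) = of_bool (i = k)) \<and> closure (L2.span (range e)) = S"

definition MRA :: "(int \<Rightarrow> L2 set) \<Rightarrow> L2 \<Rightarrow> bool" where
  "MRA V \<phi> \<longleftrightarrow>
     (\<forall>j. L2.subspace (V j) \<and> closed (V j)) \<and>
     (\<forall>j. V j \<subseteq> V (j + 1)) \<and>
     (\<forall>j f. f \<in> V j \<longleftrightarrow> dilate2 f \<in> V (j + 1)) \<and>
     (\<Inter>j. V j) = {0} \<and>
     closure (\<Union>j. V j) = UNIV \<and>
     orthonormal_basis (\<lambda>k. dyadic 0 k \<phi>) (V 0)"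

definition associated_wavelet :: "(int \<Rightarrow> L2 set) \<Rightarrow> L2 \<Rightarrow> bool" where
  "associated_wavelet V \<psi> \<longleftrightarrow>
     orthonormal_basis (\<lambda>k. dyadic 0 k \<psi>) {f \<in> V 1. \<forall>g \<in> V 0. cinner f g = 0}"


section \<open>The reconstruction spaces\<close>

definition Omega :: "L2 \<Rightarrow> L2 \<Rightarrow> real \<Rightarrow> L2 set" where
  "Omega \<phi> \<psi> a =
     {dyadic 0 k \<phi> | k. \<bar>k\<bar> \<le> \<lceil>a\<rceil> - 1} \<union>
     {dyadic (int j) k \<psi> | (j::nat) k. - \<lceil>a\<rceil> + 1 \<le> k \<and> k \<le> 2 ^ j * \<lceil>a\<rceil> - 1}"

definition wavelet_level :: "L2 \<Rightarrow> real \<Rightarrow> nat \<Rightarrow> L2 list" where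
  "wavelet_level \<psi> a j = map (\<lambda>k. dyadic (int j) k \<psi>) [- \<lceil>a\<rceil> + 1 .. 2 ^ j * \<lceil>a\<rceil> - 1]"

definition recon_list :: "L2 \<Rightarrow> L2 \<Rightarrow> real \<Rightarrow> nat \<Rightarrow> L2 list" where
  "recon_list \<phi> \<psi> a J =
     map (\<lambda>k. dyadic 0 k \<phi>) [- \<lceil>a\<rceil> + 1 .. \<lceil>a\<rceil> - 1] @ concat (map (wavelet_level \<psi> a) [0..<J])"

text \<open>
  The enumeration \<open>\<phi>\<^sub>1, \<phi>\<^sub>2, \<dots>\<close> of \<^const>\<open>Omega\<close>, indexed from 1. For \<open>a \<ge> 1\<close> no level is
  empty, so the first \<open>n\<close> levels together with the scaling functions reach the \<open>n\<close>-th element.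
\<close>

definition recon_fun :: "L2 \<Rightarrow> L2 \<Rightarrow> real \<Rightarrow> nat \<Rightarrow> L2" where
  "recon_fun \<phi> \<psi> a n = recon_list \<phi> \<psi> a n ! (n - 1)"

definition recon_space :: "L2 \<Rightarrow> L2 \<Rightarrow> real \<Rightarrow> nat \<Rightarrow> L2 set" where
  "recon_space \<phi> \<psi> a N = L2.span (recon_fun \<phi> \<psi> a ` {1..N})"

definition N_level :: "real \<Rightarrow> nat \<Rightarrow> nat" where
  "N_level a R = 2 ^ R * nat \<lceil>a\<rceil> + (R + 1) * (nat \<lceil>a\<rceil> - 1)"

lemma recon_list_Suc:
  "recon_list \<phi> \<psi> a (Suc J) = recon_list \<phi> \<psi> a J @ wavelet_level \<psi> a J"
  by (simp add: recon_list_def)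

lemma length_recon_list:
  assumes "a \<ge> 1"
  shows "length (recon_list \<phi> \<psi> a R) = N_level a R"
proof -
  obtain b where b: "\<lceil>a\<rceil> = int (Suc b)"
  proof
    show "\<lceil>a\<rceil> = int (Suc (nat (\<lceil>a\<rceil> - 1)))"
      using assms by linarith
  qed
  then have nat_a: "nat \<lceil>a\<rceil> = Suc b"
    by (simp only: nat_int)
  have len: "length (wavelet_level \<psi> a j) = 2 ^ j * Suc b + b" for j
  proof -
    have "2 ^ j * int (Suc b) - 1 - (- int (Suc b) + 1) + 1 = int (2 ^ j * Suc b + b)"
      by (simp add: algebra_simps)
    then show ?thesis
      unfolding wavelet_level_def length_map length_upto b by (metis nat_int)
  qed
  show ?thesis
    unfolding N_level_def nat_a
  proof (induction R)
    case 0
    have "int (Suc b) - 1 - (- int (Suc b) + 1) + 1 = int (2 * b + 1)"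
      by simp
    then have "length (recon_list \<phi> \<psi> a 0) = 2 * b + 1"
      unfolding recon_list_def b by (simp only: length_append length_map length_upto nat_int) simp
    then show ?case by simp
  next
    case (Suc R)
    then show ?case
      by (simp add: recon_list_Suc len algebra_simps)
  qed
qed

lemma recon_list_append:
  "J \<le> K \<Longrightarrow> \<exists>zs. recon_list \<phi> \<psi> a K = recon_list \<phi> \<psi> a J @ zs"
  by (induction K rule: dec_induct) (auto simp: recon_list_Suc)

lemma N_level_gt: "a \<ge> 1 \<Longrightarrow> R < N_level a R"
proof -
  assume "a \<ge> 1"
  then have "1 \<le> nat \<lceil>a\<rceil>"
    by linarith
  then have "2 ^ R * 1 \<le> N_level a R"
    unfolding N_level_def by (intro trans_le_add1 mult_left_mono) auto
  then show ?thesis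
    using less_exp[of R] by linarith
qed

lemma recon_fun_eq:
  assumes "a \<ge> 1" "n \<ge> 1" "n \<le> N_level a J"
  shows "recon_fun \<phi> \<psi> a n = recon_list \<phi> \<psi> a J ! (n - 1)"
proof -
  have "n \<le> length (recon_list \<phi> \<psi> a n)"
    using N_level_gt[of a n] assms(1) by (simp add: length_recon_list)
  moreover have "n \<le> length (recon_list \<phi> \<psi> a J)"
    using assms by (simp add: length_recon_list)
  ultimately show ?thesis
    using recon_list_append[of n J \<phi> \<psi> a] recon_list_append[of J n \<phi> \<psi> a] assms(2)
    by (cases "n \<le> J") (auto simp: recon_fun_def nth_append)
qed

lemma recon_fun_image_N_level:
  assumes "a \<ge> 1"
  shows "recon_fun \<phi> \<psi> a ` {1..N_level a R} = set (recon_list \<phi> \<psi> a R)"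
proof -
  have "recon_fun \<phi> \<psi> a ` {1..N_level a R} =
      (\<lambda>n. recon_list \<phi> \<psi> a R ! (n - 1)) ` {1..N_level a R}"
    using assms by (intro image_cong refl recon_fun_eq) auto
  also have "\<dots> = (\<lambda>n. recon_list \<phi> \<psi> a R ! n) ` {0..<N_level a R}"
    by (force simp: image_iff intro: bexI[of _ "Suc _"])
  also have "\<dots> = set (recon_list \<phi> \<psi> a R)"
    using assms by (auto simp: set_conv_nth length_recon_list)
  finally show ?thesis .
qed

lemma range_recon_fun:
  assumes "a \<ge> 1"
  shows "recon_fun \<phi> \<psi> a ` {1..} = Omega \<phi> \<psi> a"
proof -
  have "{1..} = (\<Union>R. {1..N_level a R})"
    using less_imp_le[OF N_level_gt[OF assms]] by fastforce
  then have "recon_fun \<phi> \<psi> a ` {1..} = (\<Union>R. set (recon_list \<phi> \<psi> a R))"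
    by (simp only: image_UN recon_fun_image_N_level[OF assms])
  also have "\<dots> = Omega \<phi> \<psi> a"
    by (auto simp: recon_list_def wavelet_level_def Omega_def image_iff abs_le_iff) force+
  finally show ?thesis .
qed


section \<open>Fourier samples\<close>

lift_definition sampler :: "real \<Rightarrow> real \<Rightarrow> real \<Rightarrow> int \<Rightarrow> L2" is
  "\<lambda>T1 T2 \<epsilon> l x. complex_of_real (sqrt \<epsilon>) * cis (2 * pi * real_of_int l * \<epsilon> * x) *
     indicator {- T1 / (\<epsilon> * (T1 + T2)) .. T2 / (\<epsilon> * (T1 + T2))} x"
proof -
  fix T1 T2 \<epsilon> :: real and l :: int
  define A where "A = {- T1 / (\<epsilon> * (T1 + T2)) .. T2 / (\<epsilon> * (T1 + T2))}"
  have [measurable]: "A \<in> sets borel"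
    by (simp add: A_def)
  have eq: "(cmod (complex_of_real (sqrt \<epsilon>) * cis (2 * pi * real_of_int l * \<epsilon> * x) * indicator A x))\<^sup>2
      = \<bar>\<epsilon>\<bar> * indicator A x" for x :: real
    by (auto simp: norm_mult power_mult_distrib indicator_def)
      (simp add: power2_eq_square)
  have [measurable]: "cis \<in> borel_measurable borel"
    by (intro borel_measurable_continuous_onI continuous_intros)
  have "integrable lborel (\<lambda>x. \<bar>\<epsilon>\<bar> * indicator A x :: real)"
    by (intro integrable_mult_right) (auto simp: A_def emeasure_lborel_Icc_eq)
  then have "square_integrable
      (\<lambda>x. complex_of_real (sqrt \<epsilon>) * cis (2 * pi * real_of_int l * \<epsilon> * x) * indicator A x)"
    unfolding square_integrable_def eq by simp
  then show "L2_eq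
      (\<lambda>x. complex_of_real (sqrt \<epsilon>) * cis (2 * pi * real_of_int l * \<epsilon> * x) *
        indicator {- T1 / (\<epsilon> * (T1 + T2)) .. T2 / (\<epsilon> * (T1 + T2))} x)
      (\<lambda>x. complex_of_real (sqrt \<epsilon>) * cis (2 * pi * real_of_int l * \<epsilon> * x) *
        indicator {- T1 / (\<epsilon> * (T1 + T2)) .. T2 / (\<epsilon> * (T1 + T2))} x)"
    unfolding A_def[symmetric] by (simp add: L2_eq_def)
qed

definition sample_range :: "nat \<Rightarrow> int set" where
  "sample_range M = {- \<lfloor>real M / 2\<rfloor> .. \<lceil>real M / 2\<rceil> - 1}"

text \<open>
  A vector in $\mathbb{C}^M$ is represented by a function on \<^const>\<open>sample_range\<close>, which has
  \<open>M\<close> elements; it is set to \<^const>\<open>undefined\<close> elsewhere, so that equality of functions is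
  equality of vectors.
\<close>

definition samples :: "real \<Rightarrow> real \<Rightarrow> real \<Rightarrow> nat \<Rightarrow> L2 \<Rightarrow> int \<Rightarrow> complex" where
  "samples T1 T2 \<epsilon> M f = (\<lambda>l\<in>sample_range M. cinner f (sampler T1 T2 \<epsilon> l))"

definition samples_norm :: "real \<Rightarrow> real \<Rightarrow> real \<Rightarrow> nat \<Rightarrow> L2 \<Rightarrow> real" where
  "samples_norm T1 T2 \<epsilon> M f = L2_set (\<lambda>l. cmod (samples T1 T2 \<epsilon> M f l)) (sample_range M)"

lemma card_sample_range: "card (sample_range M) = M"
proof -
  have "\<lceil>real M / 2\<rceil> + \<lfloor>real M / 2\<rfloor> = int M"
  proof (cases "even M")
    case True
    then show ?thesis by (auto elim!: evenE)
  next
    case False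
    then obtain k where k: "M = 2 * k + 1" by (rule oddE)
    have "\<lfloor>real M / 2\<rfloor> = int k" "\<lceil>real M / 2\<rceil> = int k + 1"
      unfolding k by (intro floor_unique ceiling_unique; simp add: field_simps)+
    then show ?thesis by (simp add: k)
  qed
  then show ?thesis
    by (simp add: sample_range_def)
qed


section \<open>Reconstruction methods\<close>

definition reconstruction_method ::
    "real \<Rightarrow> real \<Rightarrow> real \<Rightarrow> nat \<Rightarrow> L2 set \<Rightarrow> (L2 \<Rightarrow> L2) \<Rightarrow> bool" where
  "reconstruction_method T1 T2 \<epsilon> M S F \<longleftrightarrow>
     range F \<subseteq> S \<and>
     (\<forall>f g. samples T1 T2 \<epsilon> M f = samples T1 T2 \<epsilon> M g \<longrightarrow> F f = F g)"

definition perfect :: "L2 set \<Rightarrow> (L2 \<Rightarrow> L2) \<Rightarrow> bool" where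
  "perfect S F \<longleftrightarrow> (\<forall>f\<in>S. F f = f)"

definition sampling_ratio :: "(nat \<Rightarrow> nat) \<Rightarrow> ereal" where
  "sampling_ratio \<Theta> = limsup (\<lambda>N. ereal (real (\<Theta> N) / real N))"

text \<open>The condition number takes values in \<open>[0, \<infinity>]\<close>.\<close>

definition condition_number ::
    "real \<Rightarrow> real \<Rightarrow> real \<Rightarrow> nat \<Rightarrow> (L2 \<Rightarrow> L2) \<Rightarrow> ennreal" where
  "condition_number T1 T2 \<epsilon> M F =
     (SUP f. Lim (at_right (0::real)) (\<lambda>t.
        SUP g\<in>{g. 0 < samples_norm T1 T2 \<epsilon> M g \<and> samples_norm T1 T2 \<epsilon> M g \<le> t}.
          ennreal (norm (F (f + g) - F f) / samples_norm T1 T2 \<epsilon> M g)))"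

end

theory Submission
  imports Defs
begin

text \<open>
  A perfect method reproduces every \<open>h\<close> in the reconstruction space, so its condition number is at
  least the norm of \<open>h\<close> divided by the norm of the samples of \<open>h\<close>. The space of dimension \<open>N_level a R\<close>
  contains the scaling functions \<open>dyadic R k \<phi>\<close> for \<open>0 \<le> k < 2 ^ R\<close>, and in a combination of these a
  sample at \<open>l\<close> is, up to a factor bounded by 1, the value at frequency \<open>l * \<epsilon> / 2 ^ R\<close> of a
  1-periodic trigonometric polynomial. Below the critical sampling ratio the sampled frequencies
  stay in an interval \<open>[- c, c]\<close> with \<open>c < 1 / 2\<close>. The polynomial \<open>((1 - z) / 2) ^ n\<close> with
  \<open>n = 2 ^ R - 1\<close> is bounded there by \<open>sin (\<pi> * c) ^ n\<close>, while its norm decays only like a power of \<open>n\<close>.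
\<close>

section \<open>Complex inner product and supports in \<open>L2\<close>\<close>

lemma cinner_add_left: "cinner (f + g) h = cinner f h + cinner g h"
  by transfer (simp add: L2_eq_def integrable_mult_cnj distrib_right)

lemma cinner_scaleC_left: "cinner (scaleC c f) g = c * cinner f g"
  by transfer (simp add: mult.assoc)

lemma cinner_zero_left [simp]: "cinner 0 g = 0"
  by transfer simp

lemma cnj_cinner: "cnj (cinner f g) = cinner g f"
  by transfer (subst Bochner_Integration.integral_cnj[symmetric], simp add: mult.commute)

lemma cinner_sum_left: "cinner (sum f A) g = (\<Sum>i\<in>A. cinner (f i) g)"
  by (induction A rule: infinite_finite_induct) (simp_all add: cinner_add_left)

lemma cinner_diff_left: "cinner (f - g) h = cinner f h - cinner g h"
  unfolding minus_L2_def uminus_L2_def cinner_add_left cinner_scaleC_left by simp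

lemma cinner_eq_0_sym: "cinner f g = 0 \<Longrightarrow> cinner g f = 0"
  using cnj_cinner[of f g] by simp

lemma cinner_self: "cinner f f = complex_of_real ((norm f)\<^sup>2)"
proof -
  have re: "Re (cinner f f) = (norm f)\<^sup>2"
    unfolding inner_L2_def[symmetric] by (rule power2_norm_eq_inner[symmetric])
  have im: "Im (cinner f f) = 0"
    using arg_cong[OF cnj_cinner[of f f], of Im] by simp
  show ?thesis
    by (rule complex_eqI) (simp_all only: re im Re_complex_of_real Im_complex_of_real)
qed

lemma cinner_scaleC_right: "cinner f (scaleC c g) = cnj c * cinner f g"
  using arg_cong[OF cinner_scaleC_left[of c g f], of cnj] by (simp add: cnj_cinner)

lemma norm_scaleC: "norm (scaleC c f) = cmod c * norm f"
proof (rule power2_eq_imp_eq)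
  have "complex_of_real ((norm (scaleC c f))\<^sup>2) = (c * cnj c) * cinner f f"
    by (simp only: cinner_self[symmetric] cinner_scaleC_left cinner_scaleC_right mult.assoc mult.left_commute)
  also have "\<dots> = complex_of_real ((cmod c * norm f)\<^sup>2)"
    by (simp only: complex_norm_square[symmetric] cinner_self of_real_mult of_real_power power_mult_distrib)
  finally show "(norm (scaleC c f))\<^sup>2 = (cmod c * norm f)\<^sup>2"
    by (simp only: of_real_eq_iff)
qed simp_all

text \<open>Multiplying \<open>f\<close> by a suitable phase \<open>u\<close> makes the inner
  product real and nonnegative, so Cauchy-Schwarz for the real part \<open>inner\<close> applies
  without loss.\<close>

lemma cmod_cinner_le: "cmod (cinner f g) \<le> norm f * norm g"
proof (cases "cinner f g = 0")
  case False
  define u where "u = cnj (cinner f g) / complex_of_real (cmod (cinner f g))"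
  have u: "cmod u = 1"
    unfolding u_def norm_divide complex_mod_cnj norm_of_real using False by simp
  have "u * cinner f g = cinner f g * cnj (cinner f g) / complex_of_real (cmod (cinner f g))"
    by (simp add: u_def)
  also have "\<dots> = complex_of_real ((cmod (cinner f g))\<^sup>2 / cmod (cinner f g))"
    by (simp only: complex_norm_square[symmetric] of_real_divide)
  finally have "Re (u * cinner f g) = cmod (cinner f g)"
    by (simp only: Re_complex_of_real power2_eq_square nonzero_mult_div_cancel_left False norm_eq_zero
        not_False_eq_True)
  then have "cmod (cinner f g) = inner (scaleC u f) g"
    by (simp only: inner_L2_def cinner_scaleC_left)
  also have "\<dots> \<le> norm (scaleC u f) * norm g"
    by (rule norm_cauchy_schwarz)
  finally show ?thesis
    by (simp add: norm_scaleC u)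
qed simp

lemma cinner_span_eq_0:
  assumes "\<And>e. e \<in> S \<Longrightarrow> cinner e g = 0" "f \<in> L2.span S"
  shows "cinner f g = 0"
  using assms(2)
  by (induction rule: L2.span_induct_alt) (simp_all add: cinner_add_left cinner_scaleC_left assms(1))

text \<open>The complex condition splits into two real ones, against \<open>h\<close> and
  \<open>scaleC \<i> h\<close>, each closed by continuity of \<open>inner\<close>.\<close>

lemma closed_orthogonal: "closed {f. cinner f h = 0}"
proof -
  have "cinner f h = 0 \<longleftrightarrow> inner f h = 0 \<and> inner f (scaleC \<i> h) = 0" for f
    by (simp add: inner_L2_def cinner_scaleC_right complex_eq_iff)
  then have "{f. cinner f h = 0} = {f. inner f h = 0} \<inter> {f. inner f (scaleC \<i> h) = 0}"
    by auto
  then show ?thesis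
    by (simp only:) (intro closed_Int closed_Collect_eq continuous_intros)
qed

text \<open>Orthogonality to \<open>h\<close> passes from the basis to its span by linearity and
  from there to the closure by \<open>closed_orthogonal\<close>.\<close>

lemma orthonormal_basis_orthogonal:
  assumes "orthonormal_basis e S" "g \<in> S" "\<And>i. cinner (e i) h = 0"
  shows "cinner g h = 0"
proof -
  have "L2.span (range e) \<subseteq> {f. cinner f h = 0}"
    using cinner_span_eq_0[of "range e" h] assms(3) by auto
  then have "closure (L2.span (range e)) \<subseteq> {f. cinner f h = 0}"
    by (rule closure_minimal) (rule closed_orthogonal)
  then show ?thesis
    using assms(1,2) by (auto simp: orthonormal_basis_def)
qed

lemma orthonormal_basis_mem: "orthonormal_basis e S \<Longrightarrow> e i \<in> S"
  unfolding orthonormal_basis_def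
  by (metis L2.span_base closure_subset rangeI subsetD)

section \<open>Supports up to null sets\<close>

text \<open>Unlike the exact set \<open>ess_support\<close>, this predicate is monotone in
  \<open>S\<close> and lets single points be dropped from \<open>S\<close>.\<close>

lift_definition supported_in :: "real set \<Rightarrow> L2 \<Rightarrow> bool" is
  "\<lambda>S f. AE x in lborel. x \<notin> S \<longrightarrow> f x = 0"
proof -
  fix S and f g :: "real \<Rightarrow> complex"
  assume "L2_eq f g"
  then have "AE x in lborel. (x \<notin> S \<longrightarrow> f x = 0) = (x \<notin> S \<longrightarrow> g x = 0)"
    by (auto simp: L2_eq_def)
  then show "(AE x in lborel. x \<notin> S \<longrightarrow> f x = 0) = (AE x in lborel. x \<notin> S \<longrightarrow> g x = 0)"
    by (rule eventually_subst)
qed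

lemma supported_in_mono: "supported_in S f \<Longrightarrow> S \<subseteq> T \<Longrightarrow> supported_in T f"
  by transfer (erule eventually_mono, blast)

lemma supported_in_zero: "supported_in S 0"
  by transfer simp

lemma supported_in_add: "supported_in S f \<Longrightarrow> supported_in S g \<Longrightarrow> supported_in S (f + g)"
  by transfer (erule (1) eventually_elim2, simp)

lemma supported_in_scaleC: "supported_in S f \<Longrightarrow> supported_in S (scaleC c f)"
  by transfer (erule eventually_mono, simp)

lemma cinner_disjoint_support:
  assumes "supported_in S f" "supported_in T g" "S \<inter> T = {}"
  shows "cinner f g = 0"
  using assms
proof (transfer fixing: S T)
  fix f g
  assume *: "L2_eq f f" "AE x in lborel. x \<notin> S \<longrightarrow> f x = 0"
    "L2_eq g g" "AE x in lborel. x \<notin> T \<longrightarrow> g x = 0" "S \<inter> T = {}"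
  from *(2,4) have "AE x in lborel. f x * cnj (g x) = 0"
    by eventually_elim (use *(5) in auto)
  then show "(\<integral>x. f x * cnj (g x) \<partial>lborel) = 0"
    by (rule integral_eq_zero_AE)
qed

text \<open>The open sets on which \<open>f\<close> vanishes may be uncountably many; by Lindelof
  countably many have the same union, so the exceptional null sets add up to a null set.\<close>

lemma supported_in_ess_support: "supported_in (ess_support f) f"
proof transfer
  fix f :: "real \<Rightarrow> complex"
  define \<U> where "\<U> = {U. open U \<and> (AE x in lborel. x \<in> U \<longrightarrow> f x = 0)}"
  obtain \<V> where \<V>: "\<V> \<subseteq> \<U>" "countable \<V>" "\<Union>\<V> = \<Union>\<U>"
    using Lindelof[of \<U>] by (auto simp: \<U>_def)
  have "AE x in lborel. \<forall>U\<in>\<V>. x \<in> U \<longrightarrow> f x = 0"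
    using \<V> by (subst AE_ball_countable) (auto simp: \<U>_def)
  then show "AE x in lborel. x \<notin> - \<Union>{U. open U \<and> (AE x in lborel. x \<in> U \<longrightarrow> f x = 0)} \<longrightarrow> f x = 0"
  proof eventually_elim
    case (elim x)
    then show ?case
      using \<V>(3) unfolding \<U>_def[symmetric] by (metis ComplI UnionE)
  qed
qed

text \<open>With open intervals, functions whose supports touch only at an endpoint count as
  disjointly supported. This settles the boundary indices for integer \<open>a\<close>.\<close>

lemma supported_in_interior_Icc: "supported_in {l..u} f \<Longrightarrow> supported_in {l<..<u} f"
proof transfer
  fix l u and f :: "real \<Rightarrow> complex"
  assume "AE x in lborel. x \<notin> {l..u} \<longrightarrow> f x = 0"
  then show "AE x in lborel. x \<notin> {l<..<u} \<longrightarrow> f x = 0"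
    using AE_lborel_singleton[of l] AE_lborel_singleton[of u] by eventually_elim auto
qed

text \<open>Since \<open>S\<close> may be non-measurable, a measurable null set \<open>N\<close>
  covering the exceptional points is pulled back along the affine map.\<close>

lemma AE_supported_affine:
  fixes f :: "real \<Rightarrow> 'a::zero"
  assumes "AE x in lborel. x \<notin> S \<longrightarrow> f x = 0" "c \<noteq> 0"
  shows "AE x in lborel. c * x - t \<notin> S \<longrightarrow> f (c * x - t) = 0"
proof -
  from assms(1) obtain N where N: "{x. \<not> (x \<notin> S \<longrightarrow> f x = 0)} \<subseteq> N" "N \<in> null_sets lborel"
    by (auto simp: eventually_ae_filter)
  then have "AE x in lborel. x \<notin> N"
    by (intro AE_not_in)
  then have "AE x in lborel. - t + c * x \<notin> N"
    using N(2) assms(2) by (intro AE_borel_affine) auto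
  then show ?thesis
    by eventually_elim (use N(1) in \<open>auto simp: add.commute\<close>)
qed

section \<open>Dyadic dilations and translations\<close>

lemma supported_in_dyadic:
  "supported_in S f \<Longrightarrow> supported_in {x. 2 powr real_of_int j * x - real_of_int k \<in> S} (dyadic j k f)"
proof transfer
  fix S j k and f :: "real \<Rightarrow> complex"
  assume "AE x in lborel. x \<notin> S \<longrightarrow> f x = 0"
  then have "AE x in lborel. 2 powr real_of_int j * x - real_of_int k \<notin> S \<longrightarrow>
      f (2 powr real_of_int j * x - real_of_int k) = 0"
    by (rule AE_supported_affine) simp
  then show "AE x in lborel. x \<notin> {x. 2 powr real_of_int j * x - real_of_int k \<in> S} \<longrightarrow>
      complex_of_real (2 powr (real_of_int j / 2)) * f (2 powr real_of_int j * x - real_of_int k) = 0"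
    by eventually_elim simp
qed

lemma square_integrable_dyadic:
  "square_integrable f \<Longrightarrow>
    square_integrable (\<lambda>x. complex_of_real c * f (2 powr real_of_int j * x - t))"
  by (rule square_integrable_mult, erule square_integrable_affine) simp

lemma dyadic_add: "dyadic j k (f + g) = dyadic j k f + dyadic j k g"
  by transfer (simp add: L2_eq_def distrib_left square_integrable_add square_integrable_dyadic)

lemma dyadic_scaleC: "dyadic j k (scaleC c f) = scaleC c (dyadic j k f)"
  by transfer (simp add: L2_eq_def mult.left_commute square_integrable_mult square_integrable_dyadic)

text \<open>The outer operator carries no translation, so exponents add and \<open>k\<close> is
  unchanged. Facts about level \<open>j\<close> thereby reduce to level 0.\<close>

lemma dyadic_dyadic: "dyadic j 0 (dyadic i k f) = dyadic (i + j) k f"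
proof transfer
  fix i j k :: int and f :: "real \<Rightarrow> complex"
  assume "L2_eq f f"
  then have "square_integrable (\<lambda>x. complex_of_real (2 powr (real_of_int (i + j) / 2)) *
      f (2 powr real_of_int (i + j) * x - real_of_int k))"
    by (auto simp: L2_eq_def simp del: of_int_add intro: square_integrable_dyadic)
  moreover have "(\<lambda>x. complex_of_real (2 powr (real_of_int j / 2)) *
        (complex_of_real (2 powr (real_of_int i / 2)) *
          f (2 powr real_of_int i * (2 powr real_of_int j * x - real_of_int 0) - real_of_int k))) =
      (\<lambda>x. complex_of_real (2 powr (real_of_int (i + j) / 2)) *
        f (2 powr real_of_int (i + j) * x - real_of_int k))"
    by (simp add: powr_add add_divide_distrib mult.assoc mult.left_commute)
  ultimately show "L2_eq (\<lambda>x. complex_of_real (2 powr (real_of_int j / 2)) *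
        (complex_of_real (2 powr (real_of_int i / 2)) *
          f (2 powr real_of_int i * (2 powr real_of_int j * x - real_of_int 0) - real_of_int k)))
      (\<lambda>x. complex_of_real (2 powr (real_of_int (i + j) / 2)) *
        f (2 powr real_of_int (i + j) * x - real_of_int k))"
    by (simp add: L2_eq_def)
qed

lemma dyadic_0_0: "dyadic 0 0 f = f"
  by transfer simp

lemma dyadic_zero: "dyadic j k 0 = 0"
  by (metis L2.scale_zero_left dyadic_scaleC)

lemma dyadic_span:
  assumes "f \<in> L2.span S"
  shows "dyadic j k f \<in> L2.span (dyadic j k ` S)"
  using assms
proof (induction rule: L2.span_induct_alt)
  case base
  then show ?case
    by (simp add: dyadic_zero L2.span_zero)
next
  case (step c x y)
  then show ?case
    by (simp add: dyadic_add dyadic_scaleC L2.span_add L2.span_scale L2.span_base)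
qed

text \<open>The two normalising factors multiply to \<open>2 powr j\<close>, which cancels the
  Jacobian of the substitution.\<close>

lemma cinner_dyadic: "cinner (dyadic j k f) (dyadic j k g) = cinner f g"
proof transfer
  fix j k :: int and f g :: "real \<Rightarrow> complex"
  define c where "c = 2 powr real_of_int j"
  have c: "c > 0" and cc: "2 powr (real_of_int j / 2) * 2 powr (real_of_int j / 2) = c"
    by (simp_all add: c_def flip: powr_add)
  have "(\<integral>x. f x * cnj (g x) \<partial>lborel) =
      c *\<^sub>R (\<integral>x. f (- k + c * x) * cnj (g (- k + c * x)) \<partial>lborel)"
    using lborel_integral_real_affine[of c "\<lambda>x. f x * cnj (g x)" "- k"] c by simp
  moreover have "complex_of_real (2 powr (real_of_int j / 2)) * f (2 powr real_of_int j * x - real_of_int k) *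
        cnj (complex_of_real (2 powr (real_of_int j / 2)) * g (2 powr real_of_int j * x - real_of_int k))
      = complex_of_real c * (f (- k + c * x) * cnj (g (- k + c * x)))" for x
  proof -
    have "complex_of_real c = complex_of_real (2 powr (real_of_int j / 2)) * complex_of_real (2 powr (real_of_int j / 2))"
      by (simp only: of_real_mult[symmetric] cc)
    then show ?thesis
      by (simp add: c_def[symmetric] algebra_simps)
  qed
  ultimately show "(\<integral>x. complex_of_real (2 powr (real_of_int j / 2)) * f (2 powr real_of_int j * x - real_of_int k) *
        cnj (complex_of_real (2 powr (real_of_int j / 2)) * g (2 powr real_of_int j * x - real_of_int k)) \<partial>lborel)
      = (\<integral>x. f x * cnj (g x) \<partial>lborel)"
    by (simp add: scaleR_conv_of_real)
qed

text \<open>This links the unnormalised dilation in \<open>MRA\<close> to the unitary operators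
  \<open>dyadic\<close>.\<close>

lemma dyadic_1_dilate2: "dyadic 1 0 f = scaleC (complex_of_real (sqrt 2)) (dilate2 f)"
proof transfer
  fix f :: "real \<Rightarrow> complex"
  assume "L2_eq f f"
  then have "square_integrable (\<lambda>x. complex_of_real (sqrt 2) * f (2 * x - 0))"
    using square_integrable_dyadic[of f "sqrt 2" 1 0] by (simp add: L2_eq_def)
  then show "L2_eq (\<lambda>x. complex_of_real (2 powr (real_of_int 1 / 2)) *
      f (2 powr real_of_int 1 * x - real_of_int 0)) (\<lambda>x. complex_of_real (sqrt 2) * f (2 * x))"
    by (simp add: L2_eq_def powr_half_sqrt)
qed

section \<open>Scaling functions in the reconstruction space\<close>

definition bounded_support :: "L2 \<Rightarrow> bool" where
  "bounded_support f \<longleftrightarrow> (\<exists>B. supported_in {- B<..<B} f)"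

lemma bounded_supportI:
  assumes "supported_in S f" "\<And>x. x \<in> S \<Longrightarrow> \<bar>x\<bar> < B"
  shows "bounded_support f"
  unfolding bounded_support_def
  by (intro exI[of _ B] supported_in_mono[OF assms(1)]) (auto dest!: assms(2))

lemma bounded_support_zero: "bounded_support 0"
  using supported_in_zero bounded_support_def by blast

lemma bounded_support_scaleC: "bounded_support f \<Longrightarrow> bounded_support (scaleC c f)"
  using supported_in_scaleC bounded_support_def by blast

lemma bounded_support_add: "bounded_support f \<Longrightarrow> bounded_support g \<Longrightarrow> bounded_support (f + g)"
proof -
  assume "bounded_support f" "bounded_support g"
  then obtain B C where "supported_in {- B<..<B} f" "supported_in {- C<..<C} g"
    by (auto simp: bounded_support_def)
  then have "supported_in {- max B C<..<max B C} f" "supported_in {- max B C<..<max B C} g"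
    by (auto elim!: supported_in_mono)
  then show ?thesis
    using supported_in_add bounded_support_def by blast
qed

lemma bounded_support_diff: "bounded_support f \<Longrightarrow> bounded_support g \<Longrightarrow> bounded_support (f - g)"
  unfolding minus_L2_def uminus_L2_def by (intro bounded_support_add bounded_support_scaleC)

lemma bounded_support_span:
  "f \<in> L2.span S \<Longrightarrow> (\<And>e. e \<in> S \<Longrightarrow> bounded_support e) \<Longrightarrow> bounded_support f"
  by (induction rule: L2.span_induct_alt)
    (simp_all add: bounded_support_zero bounded_support_add bounded_support_scaleC)

lemma supported_in_translate:
  assumes "supported_in {0<..<a} g"
  shows "supported_in {real_of_int k<..<real_of_int k + a} (dyadic 0 k g)"
  by (rule supported_in_mono[OF supported_in_dyadic[OF assms]]) auto

text \<open>
  Bounded supports make the orthogonal projection a finite sum, so that it exists without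
  any appeal to the completeness of \<open>L2\<close>.
\<close>

lemma bounded_support_projection:
  assumes orth: "\<And>i k. cinner (dyadic 0 i g) (dyadic 0 k g) = of_bool (i = k)"
    and g: "supported_in {0<..<a} g" and f: "bounded_support f"
  obtains p where "p \<in> L2.span (range (\<lambda>k. dyadic 0 k g))" "bounded_support p"
    "\<And>k. cinner (f - p) (dyadic 0 k g) = 0"
proof -
  define e where "e k = dyadic 0 k g" for k
  obtain B where B: "supported_in {- B<..<B} f"
    using f by (auto simp: bounded_support_def)
  \<comment> \<open>Any \<open>k\<close> for which the interval from \<open>k\<close> to
    \<open>k + a\<close> meets the support of \<open>f\<close> lies in this finite range.\<close>
  define F where "F = {\<lfloor>- B - a\<rfloor>..\<lceil>B\<rceil>}"
  define p where "p = (\<Sum>i\<in>F. scaleC (cinner f (e i)) (e i))"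
  have out: "cinner f (e k) = 0" if "k \<notin> F" for k
    unfolding e_def
  proof (rule cinner_disjoint_support[OF B supported_in_translate[OF g]])
    show "{- B<..<B} \<inter> {real_of_int k<..<real_of_int k + a} = {}"
      using that unfolding F_def by (auto simp: not_le) linarith+
  qed
  have p: "p \<in> L2.span (range e)"
    unfolding p_def by (intro L2.span_sum L2.span_scale L2.span_base rangeI)
  have bs: "bounded_support (e k)" for k
    unfolding e_def by (rule bounded_supportI[OF supported_in_translate[OF g], of _ "\<bar>real_of_int k\<bar> + \<bar>a\<bar>"]) auto
  have "cinner (f - p) (e k) = 0" for k
  proof -
    have "cinner p (e k) = (\<Sum>i\<in>F. cinner f (e i) * of_bool (i = k))"
      by (simp only: p_def cinner_sum_left cinner_scaleC_left e_def orth)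
    also have "\<dots> = cinner f (e k)"
    proof (cases "k \<in> F")
      case True
      then have "F \<inter> {k} = {k}"
        by blast
      then show ?thesis
        by (simp add: F_def)
    qed (simp add: F_def out)
    finally show ?thesis
      by (simp add: cinner_diff_left)
  qed
  moreover have "bounded_support p"
    by (rule bounded_support_span[OF p]) (use bs in auto)
  ultimately show ?thesis
    using that p by (simp add: e_def)
qed

text \<open>Split \<open>f\<close> into \<open>u\<close> from \<open>F\<close> and \<open>v\<close>
  from \<open>F'\<close>. Both \<open>f\<close> and \<open>u\<close> are orthogonal to
  \<open>F'\<close>, hence so is \<open>v\<close>, which is then orthogonal to itself.\<close>

lemma span_of_orthogonal:
  assumes "f \<in> L2.span (F \<union> F')"
    and F: "\<And>e e'. e \<in> F \<Longrightarrow> e' \<in> F' \<Longrightarrow> cinner e e' = 0"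
    and f: "\<And>e'. e' \<in> F' \<Longrightarrow> cinner f e' = 0"
  shows "f \<in> L2.span F"
proof -
  obtain u v where uv: "f = u + v" "u \<in> L2.span F" "v \<in> L2.span F'"
    using assms(1) by (auto simp: L2.span_Un)
  have "cinner e' v = 0" if e': "e' \<in> F'" for e'
  proof -
    have "cinner u e' = 0"
      by (rule cinner_span_eq_0[OF _ uv(2)]) (rule F[OF _ e'])
    then have "cinner v e' = 0"
      using f[OF e'] by (simp add: uv(1) cinner_add_left)
    then show ?thesis
      by (rule cinner_eq_0_sym)
  qed
  then have "cinner v v = 0"
    by (rule cinner_span_eq_0[OF _ uv(3)])
  then have "v = 0"
    by (simp add: cinner_self)
  then show ?thesis
    using uv by simp
qed

section \<open>Multiresolution analysis with compactly supported generators\<close>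

locale compact_wavelet =
  fixes V :: "int \<Rightarrow> L2 set" and \<phi> \<psi> :: L2 and a :: real
  assumes MRA: "MRA V \<phi>" and wavelet: "associated_wavelet V \<psi>"
    and supp_\<phi>: "supported_in {0<..<a} \<phi>" and supp_\<psi>: "supported_in {0<..<a} \<psi>"
begin

lemma subspace_V: "L2.subspace (V j)"
  using MRA by (simp add: MRA_def)

lemma V_mono: "i \<le> j \<Longrightarrow> V i \<subseteq> V j"
proof (induction j rule: int_ge_induct)
  case (step j)
  have "V j \<subseteq> V (j + 1)"
    using MRA by (simp add: MRA_def)
  with step show ?case by blast
qed simp

lemma basis_\<phi>: "orthonormal_basis (\<lambda>k. dyadic 0 k \<phi>) (V 0)"
  using MRA by (simp add: MRA_def)

lemma basis_\<psi>: "orthonormal_basis (\<lambda>k. dyadic 0 k \<psi>) {f \<in> V 1. \<forall>g \<in> V 0. cinner f g = 0}"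
  using wavelet by (simp add: associated_wavelet_def)

text \<open>The dilation axiom of \<open>MRA\<close> survives the factor \<open>sqrt 2\<close>
  because each \<open>V j\<close> is a subspace.\<close>

lemma dyadic_1_mem_V_iff: "dyadic 1 0 f \<in> V (j + 1) \<longleftrightarrow> f \<in> V j"
proof -
  have "dyadic 1 0 f \<in> V (j + 1) \<longleftrightarrow> dilate2 f \<in> V (j + 1)"
  proof
    assume "dyadic 1 0 f \<in> V (j + 1)"
    then have "scaleC (1 / complex_of_real (sqrt 2)) (dyadic 1 0 f) \<in> V (j + 1)"
      by (rule L2.subspace_scale[OF subspace_V])
    then show "dilate2 f \<in> V (j + 1)"
      by (simp add: dyadic_1_dilate2)
  next
    assume "dilate2 f \<in> V (j + 1)"
    then show "dyadic 1 0 f \<in> V (j + 1)"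
      unfolding dyadic_1_dilate2 by (rule L2.subspace_scale[OF subspace_V])
  qed
  also have "\<dots> \<longleftrightarrow> f \<in> V j"
    using MRA by (simp add: MRA_def)
  finally show ?thesis .
qed

lemma dyadic_mem_V_iff: "dyadic (int n) 0 f \<in> V (j + int n) \<longleftrightarrow> f \<in> V j"
proof (induction n)
  case 0
  then show ?case by (simp add: dyadic_0_0)
next
  case (Suc n)
  have "dyadic (int (Suc n)) 0 f = dyadic 1 0 (dyadic (int n) 0 f)"
    by (simp add: dyadic_dyadic add.commute)
  then show ?case
    using dyadic_1_mem_V_iff[of "dyadic (int n) 0 f" "j + int n"] Suc by (simp add: ac_simps)
qed

lemma cinner_dyadic_\<phi>: "cinner (dyadic j k \<phi>) (dyadic j m \<phi>) = of_bool (k = m)"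
  using cinner_dyadic[of j 0 "dyadic 0 k \<phi>" "dyadic 0 m \<phi>"] basis_\<phi>
  by (simp add: dyadic_dyadic orthonormal_basis_def)

lemma cinner_dyadic_\<psi>: "cinner (dyadic j k \<psi>) (dyadic j m \<psi>) = of_bool (k = m)"
  using cinner_dyadic[of j 0 "dyadic 0 k \<psi>" "dyadic 0 m \<psi>"] basis_\<psi>
  by (simp add: dyadic_dyadic orthonormal_basis_def)

lemma dyadic_\<phi>_mem_V: "dyadic (int n) k \<phi> \<in> V (int n)"
  using dyadic_mem_V_iff[of n "dyadic 0 k \<phi>" 0] orthonormal_basis_mem[OF basis_\<phi>, of k]
  by (simp add: dyadic_dyadic)

lemma dyadic_\<psi>_mem_V: "dyadic (int n) k \<psi> \<in> V (1 + int n)"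
  using dyadic_mem_V_iff[of n "dyadic 0 k \<psi>" 1] orthonormal_basis_mem[OF basis_\<psi>, of k]
  by (simp add: dyadic_dyadic)

text \<open>Rescaling \<open>g\<close> to level 0 puts it in \<open>V 0\<close>, which the
  translates of \<open>\<psi>\<close> are orthogonal to by definition; unitarity of
  \<open>dyadic\<close> carries this back to level \<open>n\<close>.\<close>

lemma dyadic_\<psi>_orthogonal_V:
  assumes "g \<in> V (int n)"
  shows "cinner (dyadic (int n) k \<psi>) g = 0"
proof -
  define h where "h = dyadic (- int n) 0 g"
  have g: "g = dyadic (int n) 0 h"
    by (simp add: h_def dyadic_dyadic dyadic_0_0)
  then have "h \<in> V 0"
    using dyadic_mem_V_iff[of n h 0] assms by simp
  then have "cinner (dyadic 0 k \<psi>) h = 0"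
    using orthonormal_basis_mem[OF basis_\<psi>, of k] by auto
  then show ?thesis
    using cinner_dyadic[of "int n" 0 "dyadic 0 k \<psi>" h] by (simp add: g dyadic_dyadic)
qed

lemma dyadic_\<psi>_orthogonal_\<phi>: "cinner (dyadic (int n) k \<psi>) (dyadic 0 m \<phi>) = 0"
  using V_mono[of 0 "int n"] dyadic_\<phi>_mem_V[of 0 m] by (intro dyadic_\<psi>_orthogonal_V) auto

text \<open>At different levels, the coarser wavelet lies in a space \<open>V i\<close> to which the
  finer one is orthogonal; at equal levels this is orthonormality.\<close>

lemma dyadic_\<psi>_orthogonal_\<psi>:
  assumes "(i, k) \<noteq> (j, m)"
  shows "cinner (dyadic (int i) k \<psi>) (dyadic (int j) m \<psi>) = 0"
proof -
  have less: "cinner (dyadic (int i) k \<psi>) (dyadic (int j) m \<psi>) = 0" if "j < i" for i j k m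
    using V_mono[of "1 + int j" "int i"] that dyadic_\<psi>_mem_V[of j m]
    by (intro dyadic_\<psi>_orthogonal_V) auto
  consider "j < i" | "i < j" | "i = j" "k \<noteq> m"
    using assms by fastforce
  then show ?thesis
    by cases (auto simp: cinner_dyadic_\<psi> intro: less cinner_eq_0_sym)
qed

text \<open>Subtract the projection \<open>p\<close> onto the translates of \<open>\<phi>\<close>,
  then the projection \<open>q\<close> onto those of \<open>\<psi>\<close>. The remainder lies in
  \<open>W\<close> and is orthogonal to a basis of \<open>W\<close>, so it vanishes. Bounded support
  keeps both projections finite, which gives the span and not merely its closure.\<close>

lemma two_scale_span:
  assumes f: "f \<in> V 1" "bounded_support f"
  shows "f \<in> L2.span (range (\<lambda>k. dyadic 0 k \<phi>) \<union> range (\<lambda>k. dyadic 0 k \<psi>))"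
proof -
  define W where "W = {f \<in> V 1. \<forall>g \<in> V 0. cinner f g = 0}"
  have W: "L2.subspace W"
    using subspace_V[of 1] unfolding W_def L2.subspace_def
    by (auto simp: cinner_add_left cinner_scaleC_left)
  have basis_W: "orthonormal_basis (\<lambda>k. dyadic 0 k \<psi>) W"
    using basis_\<psi> by (simp add: W_def)
  obtain p where p: "p \<in> L2.span (range (\<lambda>k. dyadic 0 k \<phi>))" "bounded_support p"
    "\<And>k. cinner (f - p) (dyadic 0 k \<phi>) = 0"
    using bounded_support_projection[OF cinner_dyadic_\<phi> supp_\<phi> f(2)] by blast
  obtain q where q: "q \<in> L2.span (range (\<lambda>k. dyadic 0 k \<psi>))"
    "\<And>k. cinner (f - p - q) (dyadic 0 k \<psi>) = 0"
    using bounded_support_projection[OF cinner_dyadic_\<psi> supp_\<psi> bounded_support_diff[OF f(2) p(2)]] by blast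
  have "p \<in> V 0"
    using L2.span_minimal[OF _ subspace_V[of 0], of "range (\<lambda>k. dyadic 0 k \<phi>)"] p(1)
      orthonormal_basis_mem[OF basis_\<phi>] by blast
  then have "f - p \<in> V 1"
    using V_mono[of 0 1] f(1) by (intro L2.subspace_diff[OF subspace_V]) auto
  moreover have "cinner (f - p) g = 0" if "g \<in> V 0" for g
    by (rule cinner_eq_0_sym, rule orthonormal_basis_orthogonal[OF basis_\<phi> that])
      (rule cinner_eq_0_sym, rule p(3))
  ultimately have "f - p \<in> W"
    by (simp add: W_def)
  moreover have "q \<in> W"
    using L2.span_minimal[OF _ W, of "range (\<lambda>k. dyadic 0 k \<psi>)"] q(1)
      orthonormal_basis_mem[OF basis_W] by blast
  ultimately have "f - p - q \<in> W"
    by (rule L2.subspace_diff[OF W])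
  then have "cinner (f - p - q) (f - p - q) = 0"
    by (rule orthonormal_basis_orthogonal[OF basis_W]) (rule cinner_eq_0_sym, rule q(2))
  then have "f - p = q"
    by (simp add: cinner_self)
  then have "f = p + q"
    by (simp only: diff_eq_eq add.commute)
  then show ?thesis
    using p(1) q(1) unfolding L2.span_Un by blast
qed

text \<open>This is the decomposition of \<open>V R\<close> into \<open>V 0\<close> and the wavelet
  levels below \<open>R\<close>, for finite combinations. The induction step dilates the two-scale
  relation for \<open>dyadic 1 k \<phi>\<close> by \<open>2 ^ R\<close>.\<close>

lemma dyadic_\<phi>_span:
  "dyadic (int R) k \<phi> \<in>
    L2.span (range (\<lambda>m. dyadic 0 m \<phi>) \<union> {dyadic (int j) m \<psi> | j m. j < R})" (is "_ \<in> L2.span (?E R)")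
proof (induction R arbitrary: k)
  case 0
  then show ?case
    by (auto intro: L2.span_base)
next
  case (Suc R)
  have "bounded_support (dyadic 1 k \<phi>)"
    by (rule bounded_supportI[OF supported_in_dyadic[OF supp_\<phi>], of _ _ "\<bar>real_of_int k\<bar> + \<bar>a\<bar> + 1"]) auto
  then have "dyadic 1 k \<phi> \<in> L2.span (range (\<lambda>k. dyadic 0 k \<phi>) \<union> range (\<lambda>k. dyadic 0 k \<psi>))"
    using dyadic_\<phi>_mem_V[of 1 k] by (intro two_scale_span) simp_all
  then have "dyadic (int R) 0 (dyadic 1 k \<phi>) \<in>
      L2.span (dyadic (int R) 0 ` (range (\<lambda>k. dyadic 0 k \<phi>) \<union> range (\<lambda>k. dyadic 0 k \<psi>)))"
    by (rule dyadic_span)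
  moreover have "dyadic (int R) 0 ` (range (\<lambda>k. dyadic 0 k \<phi>) \<union> range (\<lambda>k. dyadic 0 k \<psi>))
      \<subseteq> L2.span (?E (Suc R))"
  proof -
    have "L2.span (?E R) \<subseteq> L2.span (?E (Suc R))"
      by (intro L2.span_mono Un_mono) auto
    then have "dyadic (int R) m \<phi> \<in> L2.span (?E (Suc R))" for m
      using Suc.IH[of m] by blast
    moreover have "dyadic (int R) m \<psi> \<in> L2.span (?E (Suc R))" for m
      by (intro L2.span_base) blast
    ultimately show ?thesis
      by (auto simp: dyadic_dyadic)
  qed
  ultimately have "dyadic (int R) 0 (dyadic 1 k \<phi>) \<in> L2.span (?E (Suc R))"
    using L2.span_minimal[OF _ L2.subspace_span] by blast
  then show ?case
    by (simp add: dyadic_dyadic)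
qed

text \<open>The expansion in \<open>dyadic_\<phi>_span\<close> ranges over all integer translates.
  Those missing from the reconstruction space vanish on the support of
  \<open>dyadic R k \<phi>\<close>, so \<open>span_of_orthogonal\<close> removes them.\<close>

lemma dyadic_\<phi>_mem_recon_space:
  assumes a: "a \<ge> 1" and k: "0 \<le> k" "k + \<lceil>a\<rceil> \<le> 2 ^ R * \<lceil>a\<rceil>"
  shows "dyadic (int R) k \<phi> \<in> recon_space \<phi> \<psi> a (N_level a R)"
proof -
  define I where "I = {- \<lceil>a\<rceil> + 1 .. \<lceil>a\<rceil> - 1}"
  define J where "J j = {- \<lceil>a\<rceil> + 1 .. 2 ^ j * \<lceil>a\<rceil> - 1}" for j :: nat
  \<comment> \<open>\<open>F\<close> collects the generators kept in the space and \<open>F'\<close>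
    the remaining translates at the same levels.\<close>
  define F where "F = {dyadic 0 m \<phi> | m. m \<in> I} \<union> {dyadic (int j) m \<psi> | j m. j < R \<and> m \<in> J j}"
  define F' where "F' = {dyadic 0 m \<phi> | m. m \<notin> I} \<union> {dyadic (int j) m \<psi> | j m. j < R \<and> m \<notin> J j}"
  have "set (recon_list \<phi> \<psi> a R) = F"
    unfolding recon_list_def wavelet_level_def F_def I_def J_def by auto
  then have F: "recon_space \<phi> \<psi> a (N_level a R) = L2.span F"
    unfolding recon_space_def recon_fun_image_N_level[OF a] by simp
  \<comment> \<open>The two bounds on \<open>k\<close> are exactly what confines the support to this
    interval.\<close>
  have supp: "supported_in {0<..<real_of_int \<lceil>a\<rceil>} (dyadic (int R) k \<phi>)"
  proof (rule supported_in_mono[OF supported_in_dyadic[OF supp_\<phi>]], rule subsetI)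
    fix x assume "x \<in> {x. 2 powr real_of_int (int R) * x - real_of_int k \<in> {0<..<a}}"
    then have x: "real_of_int k < 2 ^ R * x" "2 ^ R * x < real_of_int k + a"
      by (auto simp: powr_realpow)
    have "real_of_int (k + \<lceil>a\<rceil>) \<le> real_of_int (2 ^ R * \<lceil>a\<rceil>)"
      using k(2) by (simp only: of_int_le_iff)
    then have "2 ^ R * x < 2 ^ R * real_of_int \<lceil>a\<rceil>"
      using x(2) le_of_int_ceiling[of a] unfolding of_int_add of_int_mult of_int_power of_int_numeral
      by linarith
    moreover have "0 < 2 ^ R * x"
      using x(1) k(1) by (meson of_int_0_le_iff order.strict_trans1)
    ultimately show "x \<in> {0<..<real_of_int \<lceil>a\<rceil>}"
      by (simp add: zero_less_mult_iff)
  qed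
  have out: "cinner (dyadic (int R) k \<phi>) (dyadic (int j) m g) = 0"
    if "supported_in {0<..<a} g" "m \<notin> J j" for j m g
  proof (rule cinner_disjoint_support[OF supp supported_in_dyadic[OF that(1)]], rule ccontr)
    assume "{0<..<real_of_int \<lceil>a\<rceil>} \<inter> {x. 2 powr real_of_int (int j) * x - real_of_int m \<in> {0<..<a}} \<noteq> {}"
    then obtain x where x: "0 < x" "x < real_of_int \<lceil>a\<rceil>" "real_of_int m < 2 ^ j * x" "2 ^ j * x < real_of_int m + a"
      by (auto simp: powr_realpow diff_less_eq add.commute)
    have "0 < 2 ^ j * x" "2 ^ j * x < 2 ^ j * real_of_int \<lceil>a\<rceil>"
      using x by simp_all
    then have "- real_of_int m < real_of_int \<lceil>a\<rceil>" "real_of_int m < real_of_int (2 ^ j * \<lceil>a\<rceil>)"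
      using x le_of_int_ceiling[of a] unfolding of_int_mult of_int_power of_int_numeral by linarith+
    then have "- m < \<lceil>a\<rceil>" "m < 2 ^ j * \<lceil>a\<rceil>"
      by (simp_all only: of_int_less_iff flip: of_int_minus)
    then show False
      using that(2) by (auto simp: J_def)
  qed
  have "dyadic (int R) k \<phi> \<in> L2.span (F \<union> F')"
  proof (rule subsetD[OF L2.span_mono dyadic_\<phi>_span])
    show "range (\<lambda>m. dyadic 0 m \<phi>) \<union> {dyadic (int j) m \<psi> | j m. j < R} \<subseteq> F \<union> F'"
      unfolding F_def F'_def by blast
  qed
  then have "dyadic (int R) k \<phi> \<in> L2.span F"
  proof (rule span_of_orthogonal)
    fix e e' assume "e \<in> F" "e' \<in> F'"
    then show "cinner e e' = 0"
      unfolding F_def F'_def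
      by (auto simp: cinner_dyadic_\<phi> intro: dyadic_\<psi>_orthogonal_\<phi> dyadic_\<psi>_orthogonal_\<psi>
          cinner_eq_0_sym[OF dyadic_\<psi>_orthogonal_\<phi>])
  next
    fix e' assume "e' \<in> F'"
    \<comment> \<open>The scaling functions have the index range of wavelet level 0, so
      \<open>out\<close> handles both families.\<close>
    moreover have "I = J 0"
      by (simp add: I_def J_def)
    ultimately show "cinner (dyadic (int R) k \<phi>) e' = 0"
      using out[OF supp_\<phi>, of _ 0] out[OF supp_\<psi>] unfolding F'_def by auto
  qed
  then show ?thesis
    by (simp only: F)
qed

end

section \<open>Samples and the condition number\<close>

text \<open>The window has length \<open>1 / \<epsilon>\<close>, which cancels the squared amplitude
  \<open>\<epsilon>\<close>.\<close>

lemma norm_sampler: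
  assumes "0 < \<epsilon>" "0 < T1 + T2"
  shows "norm (sampler T1 T2 \<epsilon> l) = 1"
proof (transfer fixing: T1 T2 \<epsilon> l)
  define A where "A = {- T1 / (\<epsilon> * (T1 + T2)) .. T2 / (\<epsilon> * (T1 + T2))}"
  have len: "T2 / (\<epsilon> * (T1 + T2)) - - T1 / (\<epsilon> * (T1 + T2)) = 1 / \<epsilon>"
    using assms by (simp add: add.commute flip: add_divide_distrib)
  then have "- T1 / (\<epsilon> * (T1 + T2)) \<le> T2 / (\<epsilon> * (T1 + T2))"
    using assms by (smt (verit) divide_pos_pos)
  then have A: "measure lborel A = 1 / \<epsilon>"
    using len by (simp add: A_def)
  have "(cmod (complex_of_real (sqrt \<epsilon>) * cis (2 * pi * real_of_int l * \<epsilon> * x) * indicator A x))\<^sup>2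
      = \<epsilon> * indicator A x" for x :: real
    using assms by (auto simp: norm_mult power_mult_distrib indicator_def)
  then show "sqrt (\<integral>x. (cmod (complex_of_real (sqrt \<epsilon>) * cis (2 * pi * real_of_int l * \<epsilon> * x) *
      indicator {- T1 / (\<epsilon> * (T1 + T2)) .. T2 / (\<epsilon> * (T1 + T2))} x))\<^sup>2 \<partial>lborel) = 1"
    unfolding A_def[symmetric] using assms by (simp add: A)
qed

text \<open>
  Translation by \<open>k / 2 ^ R\<close> modulates the samples because the support of both functions
  stays inside the window of the sampler.
\<close>

lemma cinner_dyadic_sampler:
  assumes "supported_in {0<..<a} \<phi>" and T: "0 \<le> T1" "0 < T2" and \<epsilon>: "0 < \<epsilon>" "\<epsilon> * (T1 + T2) \<le> 1"
    and k: "0 \<le> k" "real_of_int k + a \<le> 2 ^ R * T2"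
  shows "cinner (dyadic (int R) k \<phi>) (sampler T1 T2 \<epsilon> l) =
    cis (- (2 * pi * real_of_int l * \<epsilon> * (real_of_int k / 2 ^ R))) *
    cinner (dyadic (int R) 0 \<phi>) (sampler T1 T2 \<epsilon> l)"
  using assms(1)
proof (transfer fixing: a T1 T2 \<epsilon> k R l)
  fix \<phi> :: "real \<Rightarrow> complex"
  assume \<phi>: "L2_eq \<phi> \<phi>" and supp: "AE x in lborel. x \<notin> {0<..<a} \<longrightarrow> \<phi> x = 0"
  have [measurable]: "\<phi> \<in> borel_measurable borel"
    using \<phi> by (simp add: L2_eqD square_integrable_measurable)
  have [measurable]: "cis \<in> borel_measurable borel"
    by (intro borel_measurable_continuous_onI continuous_intros)
  define A where "A = {- T1 / (\<epsilon> * (T1 + T2)) .. T2 / (\<epsilon> * (T1 + T2))}"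
  have [measurable]: "A \<in> sets borel"
    by (simp add: A_def)
  \<comment> \<open>Because \<open>\<epsilon> * (T1 + T2) \<le> 1\<close>, dividing by it only
    enlarges the window.\<close>
  have A: "x \<in> A" if "0 \<le> x" "x \<le> T2" for x
  proof -
    have "0 < \<epsilon> * (T1 + T2)"
      using T \<epsilon> by simp
    then have "- T1 / (\<epsilon> * (T1 + T2)) \<le> 0" "T2 \<le> T2 / (\<epsilon> * (T1 + T2))"
      using T \<epsilon>(2) mult_left_le[of "\<epsilon> * (T1 + T2)" T2] by (simp_all add: le_divide_eq)
    then show ?thesis
      using that by (auto simp: A_def)
  qed
  define c where "c = complex_of_real (2 powr (real_of_int (int R) / 2))"
  define s where "s x = complex_of_real (sqrt \<epsilon>) * cis (2 * pi * real_of_int l * \<epsilon> * x) * indicator A x" for x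
  define t where "t = real_of_int k / 2 ^ R"
  define w where "w = cis (- (2 * pi * real_of_int l * \<epsilon> * t))"
  have [measurable]: "s \<in> borel_measurable borel"
    unfolding s_def by measurable
  have "(\<integral>x. c * \<phi> (2 ^ R * x - real_of_int k) * cnj (s x) \<partial>lborel) =
      (\<integral>x. c * \<phi> (2 ^ R * (t + 1 * x) - real_of_int k) * cnj (s (t + 1 * x)) \<partial>lborel)"
    using lborel_integral_real_affine[of 1 "\<lambda>x. c * \<phi> (2 ^ R * x - real_of_int k) * cnj (s x)" t] by simp
  \<comment> \<open>Off the support both integrands vanish. On it, \<open>x\<close> and
    \<open>t + x\<close> both lie in the window, so the two values of \<open>s\<close> differ only
    by a phase.\<close>
  also have "\<dots> = (\<integral>x. w * (c * \<phi> (2 ^ R * x - 0) * cnj (s x)) \<partial>lborel)"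
  proof (rule integral_cong_AE)
    have "AE x in lborel. 2 ^ R * x - 0 \<notin> {0<..<a} \<longrightarrow> \<phi> (2 ^ R * x - 0) = 0"
      using supp by (rule AE_supported_affine) simp
    then show "AE x in lborel. c * \<phi> (2 ^ R * (t + 1 * x) - real_of_int k) * cnj (s (t + 1 * x)) =
        w * (c * \<phi> (2 ^ R * x - 0) * cnj (s x))"
    proof eventually_elim
      case (elim x)
      have arg: "2 ^ R * (t + x) - real_of_int k = 2 ^ R * x"
        by (simp add: t_def field_simps)
      show ?case
      proof (cases "2 ^ R * x \<in> {0<..<a}")
        case True
        have "2 ^ R * (t + x) = real_of_int k + 2 ^ R * x"
          by (simp add: t_def field_simps)
        then have "2 ^ R * (t + x) \<le> 2 ^ R * T2" "2 ^ R * x \<le> 2 ^ R * T2"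
          using k True by (simp_all only: greaterThanLessThan_iff of_int_0_le_iff[symmetric, where 'a=real]) linarith+
        then have "t + x \<le> T2" "x \<le> T2"
          by simp_all
        moreover have "0 < x" "0 \<le> t"
          using True k by (auto simp: zero_less_mult_iff t_def)
        ultimately have "x \<in> A" "t + x \<in> A"
          by (auto intro!: A)
        then have "s (t + x) = cis (2 * pi * real_of_int l * \<epsilon> * t) * s x"
          by (simp add: s_def distrib_left flip: cis_mult)
        then have "cnj (s (t + x)) = w * cnj (s x)"
          by (simp add: w_def cis_cnj)
        then show ?thesis
          by (simp add: arg)
      qed (use elim in \<open>simp add: arg\<close>)
    qed
  qed measurable
  also have "\<dots> = w * (\<integral>x. c * \<phi> (2 ^ R * x - 0) * cnj (s x) \<partial>lborel)"
    by (rule integral_mult_right_zero)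
  finally show "(\<integral>x. complex_of_real (2 powr (real_of_int (int R) / 2)) *
        \<phi> (2 powr real_of_int (int R) * x - real_of_int k) *
        cnj (complex_of_real (sqrt \<epsilon>) * cis (2 * pi * real_of_int l * \<epsilon> * x) *
          indicator {- T1 / (\<epsilon> * (T1 + T2)) .. T2 / (\<epsilon> * (T1 + T2))} x) \<partial>lborel) =
      cis (- (2 * pi * real_of_int l * \<epsilon> * (real_of_int k / 2 ^ R))) *
      (\<integral>x. complex_of_real (2 powr (real_of_int (int R) / 2)) *
        \<phi> (2 powr real_of_int (int R) * x - real_of_int 0) *
        cnj (complex_of_real (sqrt \<epsilon>) * cis (2 * pi * real_of_int l * \<epsilon> * x) *
          indicator {- T1 / (\<epsilon> * (T1 + T2)) .. T2 / (\<epsilon> * (T1 + T2))} x) \<partial>lborel)"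
    by (simp only: c_def s_def A_def w_def t_def powr_realpow of_int_of_nat_eq of_int_0 zero_less_numeral)
qed

text \<open>Taking out the half-angle phase leaves a purely imaginary number.\<close>

lemma cmod_1_minus_cis: "cmod (1 - cis (- \<theta>)) = 2 * \<bar>sin (\<theta> / 2)\<bar>"
proof -
  have "1 - cis (- \<theta>) = cis (- (\<theta> / 2)) * (cis (\<theta> / 2) - cis (- (\<theta> / 2)))"
    by (simp add: right_diff_distrib cis_mult)
  also have "cis (\<theta> / 2) - cis (- (\<theta> / 2)) = complex_of_real (2 * sin (\<theta> / 2)) * \<i>"
    by (simp add: complex_eq_iff)
  finally show ?thesis
    by (simp only: norm_mult norm_cis norm_of_real norm_ii abs_mult abs_numeral mult_1 mult_1_right)
qed

lemma abs_sin_le_sin: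
  assumes "\<bar>x\<bar> \<le> y" "y \<le> pi / 2"
  shows "\<bar>sin x\<bar> \<le> sin y"
proof -
  have "sin x \<le> sin y" "sin (- x) \<le> sin y"
    using assms by (intro sin_monotone_2pi_le; linarith)+
  then show ?thesis
    by simp
qed

lemma samples_norm_scaleC:
  "samples_norm T1 T2 \<epsilon> M (scaleC c f) = cmod c * samples_norm T1 T2 \<epsilon> M f"
proof -
  have "samples_norm T1 T2 \<epsilon> M (scaleC c f) =
      L2_set (\<lambda>l. cmod c * cmod (samples T1 T2 \<epsilon> M f l)) (sample_range M)"
    unfolding samples_norm_def
    by (intro L2_set_cong refl) (simp add: samples_def cinner_scaleC_left norm_mult)
  then show ?thesis
    by (simp add: samples_norm_def L2_set_right_distrib)
qed

text \<open>The conclusion is an equality of restricted functions, the form in which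
  \<open>reconstruction_method\<close> compares samples.\<close>

lemma samples_norm_eq_0D:
  assumes "samples_norm T1 T2 \<epsilon> M f = 0"
  shows "samples T1 T2 \<epsilon> M f = samples T1 T2 \<epsilon> M 0"
proof -
  have "finite (sample_range M)"
    by (simp add: sample_range_def)
  then have "\<forall>l\<in>sample_range M. samples T1 T2 \<epsilon> M f l = 0"
    using assms by (simp add: samples_norm_def L2_set_eq_0_iff)
  then show ?thesis
    unfolding samples_def by (intro restrict_ext) (simp add: samples_def)
qed

lemma samples_norm_le:
  assumes "\<And>l. l \<in> sample_range M \<Longrightarrow> cmod (cinner f (sampler T1 T2 \<epsilon> l)) \<le> b"
  shows "samples_norm T1 T2 \<epsilon> M f \<le> sqrt (real M) * \<bar>b\<bar>"
proof -
  have "samples_norm T1 T2 \<epsilon> M f \<le> L2_set (\<lambda>l. b) (sample_range M)"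
    unfolding samples_norm_def using assms by (intro L2_set_mono) (auto simp: samples_def)
  then show ?thesis
    by (simp add: L2_set_constant card_sample_range)
qed

text \<open>\<open>Lim\<close> is a definite description, so convergence has to be shown first: a
  monotone \<open>F\<close> tends to its infimum over positive arguments, and \<open>c\<close>
  bounds that infimum.\<close>

lemma Lim_at_right_ge:
  fixes F :: "real \<Rightarrow> ennreal"
  assumes mono: "\<And>s t. 0 < s \<Longrightarrow> s \<le> t \<Longrightarrow> F s \<le> F t" and ge: "\<And>t. 0 < t \<Longrightarrow> c \<le> F t"
  shows "c \<le> Lim (at_right 0) F"
proof -
  define L where "L = (INF t\<in>{0<..}. F t)"
  have "(F \<longlongrightarrow> L) (at_right 0)"
  proof (rule order_tendstoI)
    fix y assume "y < L"
    then show "eventually (\<lambda>t. y < F t) (at_right 0)"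
      unfolding eventually_at_right_field L_def
      by (intro exI[of _ 1]) (auto intro: order.strict_trans2 INF_lower)
  next
    fix y assume "L < y"
    then obtain t where "0 < t" "F t < y"
      by (auto simp: L_def INF_less_iff)
    then show "eventually (\<lambda>t. F t < y) (at_right 0)"
      unfolding eventually_at_right_field
      by (intro exI[of _ t]) (metis mono less_imp_le order.strict_trans1)
  qed
  then have "Lim (at_right 0) F = L"
    by (intro tendsto_Lim) simp
  moreover have "c \<le> L"
    unfolding L_def by (intro INF_greatest) (auto intro: ge)
  ultimately show ?thesis
    by simp
qed

text \<open>
  A perfect method fixes every multiple of \<open>h\<close>, so the difference quotients at the origin in the
  direction \<open>h\<close> all have the same value.
\<close>

lemma condition_number_ge:
  assumes F: "reconstruction_method T1 T2 \<epsilon> M S F" "perfect S F"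
    and S: "L2.subspace S" and h: "h \<in> S" "h \<noteq> 0"
  shows "0 < samples_norm T1 T2 \<epsilon> M h"
    and "ennreal (norm h / samples_norm T1 T2 \<epsilon> M h) \<le> condition_number T1 T2 \<epsilon> M F"
proof -
  let ?n = "samples_norm T1 T2 \<epsilon> M"
  have perf: "F f = f" if "f \<in> S" for f
    using F(2) that by (simp add: perfect_def)
  have F0: "F 0 = 0"
    using L2.subspace_0[OF S] by (rule perf)
  \<comment> \<open>With vanishing samples the method could not distinguish \<open>h\<close> from 0,
    although it reproduces both.\<close>
  have "?n h \<noteq> 0"
  proof
    assume "?n h = 0"
    then have "F h = F 0"
      using F(1) samples_norm_eq_0D unfolding reconstruction_method_def by blast
    then show False
      using h F0 by (simp add: perf)
  qed
  then show pos: "0 < ?n h"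
    by (simp add: samples_norm_def less_le)
  define Q where "Q f t = (SUP g\<in>{g. 0 < ?n g \<and> ?n g \<le> t}. ennreal (norm (F (f + g) - F f) / ?n g))" for f t
  have "ennreal (norm h / ?n h) \<le> Lim (at_right 0) (Q 0)"
  proof (rule Lim_at_right_ge)
    show "Q 0 s \<le> Q 0 t" if "s \<le> t" for s t
      unfolding Q_def using that by (intro SUP_subset_mono) auto
    fix t :: real assume t: "0 < t"
    \<comment> \<open>The multiple of \<open>h\<close> whose sample norm is exactly
      \<open>t\<close>.\<close>
    define g where "g = scaleC (complex_of_real (t / ?n h)) h"
    have n: "?n g = t" "norm g = t * (norm h / ?n h)"
      using t pos by (simp_all add: g_def samples_norm_scaleC norm_scaleC norm_divide del: of_real_divide)
    have "F g = g"
      unfolding g_def by (intro perf L2.subspace_scale[OF S] h)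
    then have "norm (F (0 + g) - F 0) / ?n g = norm h / ?n h"
      using t by (simp add: F0 n)
    then show "ennreal (norm h / ?n h) \<le> Q 0 t"
      unfolding Q_def using t n(1) by (intro SUP_upper2[of g]) auto
  qed
  also have "\<dots> \<le> (SUP f. Lim (at_right 0) (Q f))"
    by (rule SUP_upper) simp
  finally show "ennreal (norm h / ?n h) \<le> condition_number T1 T2 \<epsilon> M F"
    unfolding condition_number_def Q_def .
qed

section \<open>A binomial test function with small samples\<close>

text \<open>Parseval's identity for finitely many orthonormal translates.\<close>

lemma (in compact_wavelet) cinner_combination_\<phi>:
  "cinner (\<Sum>k\<le>n. scaleC (\<alpha> k) (dyadic j (int k) \<phi>)) (\<Sum>k\<le>n. scaleC (\<alpha> k) (dyadic j (int k) \<phi>)) =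
    (\<Sum>k\<le>n. complex_of_real ((cmod (\<alpha> k))\<^sup>2))"
proof -
  let ?f = "\<Sum>k\<le>n. scaleC (\<alpha> k) (dyadic j (int k) \<phi>)"
  have coeff: "cinner ?f (dyadic j (int k) \<phi>) = \<alpha> k" if "k \<le> n" for k
    using that by (simp add: cinner_sum_left cinner_scaleC_left cinner_dyadic_\<phi>)
  have "cinner ?f ?f = (\<Sum>k\<le>n. \<alpha> k * cinner (dyadic j (int k) \<phi>) ?f)"
    by (simp only: cinner_sum_left cinner_scaleC_left)
  also have "\<dots> = (\<Sum>k\<le>n. \<alpha> k * cnj (\<alpha> k))"
    by (intro sum.cong refl) (metis atMost_iff cnj_cinner coeff)
  finally show ?thesis
    by (simp only: complex_norm_square)
qed

text \<open>The \<open>n + 1\<close> weights sum to 1; Cauchy-Schwarz against the constant vector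
  gives the bound.\<close>

lemma sum_choose_square_ge: "(\<Sum>k\<le>n. (real (n choose k) / 2 ^ n)\<^sup>2) \<ge> 1 / real (n + 1)"
proof -
  have "1 = (\<Sum>k\<le>n. 1 * (real (n choose k) / 2 ^ n))\<^sup>2"
    using choose_row_sum[of n] by (simp flip: sum_divide_distrib of_nat_sum)
  also have "\<dots> \<le> (\<Sum>k\<le>n. 1\<^sup>2) * (\<Sum>k\<le>n. (real (n choose k) / 2 ^ n)\<^sup>2)"
    by (rule Cauchy_Schwarz_ineq_sum)
  finally show ?thesis
    by (simp add: divide_le_eq mult.commute)
qed

text \<open>Here \<open>c\<close> bounds the sampled frequencies
  \<open>l * \<epsilon> / 2 ^ R\<close> in modulus. The test function \<open>h\<close> has norm at
  least \<open>1 / sqrt (2 ^ R)\<close>, while each of its \<open>M\<close> samples is at most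
  \<open>sin (pi * c) ^ (2 ^ R - 1)\<close>.\<close>

lemma (in compact_wavelet) condition_number_level_ge:
  assumes a: "a \<ge> 1" and T: "0 \<le> T1" "real_of_int \<lceil>a\<rceil> \<le> T2" and \<epsilon>: "0 < \<epsilon>" "\<epsilon> * (T1 + T2) \<le> 1"
    and F: "reconstruction_method T1 T2 \<epsilon> M (recon_space \<phi> \<psi> a (N_level a R)) F"
      "perfect (recon_space \<phi> \<psi> a (N_level a R)) F"
    and c: "\<epsilon> * real M / (2 * 2 ^ R) \<le> c" "c \<le> 1 / 2"
  shows "ennreal (1 / (sqrt (2 ^ R) * (sqrt (real M) * sin (pi * c) ^ (2 ^ R - 1))))
    \<le> condition_number T1 T2 \<epsilon> M F"
proof -
  \<comment> \<open>All translates up to this \<open>n\<close> lie in the space, whatever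
    \<open>a \<ge> 1\<close> is; for \<open>\<lceil>a\<rceil> = 1\<close> the bound
    \<open>k_le\<close> is attained at \<open>n\<close>.\<close>
  define n :: nat where "n = 2 ^ R - 1"
  have n: "real (n + 1) = 2 ^ R"
    by (simp add: n_def)
  \<comment> \<open>Coefficients of \<open>((1 - z) / 2) ^ n\<close>: the signs put the zero at
    frequency 0 and the peak at frequency 1/2.\<close>
  define \<alpha> where "\<alpha> k = (- 1) ^ k * complex_of_real (real (n choose k) / 2 ^ n)" for k
  define h where "h = (\<Sum>k\<le>n. scaleC (\<alpha> k) (dyadic (int R) (int k) \<phi>))"
  let ?s = "sampler T1 T2 \<epsilon>"
  have pos: "0 < T2" "0 < T1 + T2"
    using T a by linarith+
  have k_le: "int k + \<lceil>a\<rceil> \<le> 2 ^ R * \<lceil>a\<rceil>" if "k \<le> n" for k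
  proof -
    have "int k \<le> 2 ^ R - 1"
      using of_nat_mono[OF that, where 'a=int] by (simp add: n_def of_nat_diff)
    moreover have "(2 ^ R - 1) * 1 \<le> (2 ^ R - 1) * \<lceil>a\<rceil>"
      using a by (intro mult_left_mono) auto
    ultimately show ?thesis
      unfolding left_diff_distrib by linarith
  qed
  have S: "L2.subspace (recon_space \<phi> \<psi> a (N_level a R))"
    by (simp add: recon_space_def)
  have h_mem: "h \<in> recon_space \<phi> \<psi> a (N_level a R)"
    unfolding h_def using k_le
    by (intro L2.subspace_sum[OF S] L2.subspace_scale[OF S] dyadic_\<phi>_mem_recon_space[OF a]) auto

  have "complex_of_real ((norm h)\<^sup>2) = (\<Sum>k\<le>n. complex_of_real ((cmod (\<alpha> k))\<^sup>2))"
    unfolding cinner_self[symmetric] h_def by (rule cinner_combination_\<phi>)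
  also have "\<dots> = complex_of_real (\<Sum>k\<le>n. (real (n choose k) / 2 ^ n)\<^sup>2)"
    by (simp add: \<alpha>_def norm_mult norm_power norm_divide)
  finally have "(norm h)\<^sup>2 = (\<Sum>k\<le>n. (real (n choose k) / 2 ^ n)\<^sup>2)"
    by (simp only: of_real_eq_iff)
  then have "1 / 2 ^ R \<le> (norm h)\<^sup>2"
    using sum_choose_square_ge[of n] unfolding n by simp
  then have norm_h: "1 / sqrt (2 ^ R) \<le> norm h"
    by (metis norm_ge_zero real_le_lsqrt real_sqrt_divide real_sqrt_le_iff real_sqrt_one real_sqrt_unique)
  have "0 < 1 / sqrt (2 ^ R :: real)"
    by simp
  then have h0: "h \<noteq> 0"
    using norm_h by (metis norm_zero not_le)

  have sample: "cmod (cinner h (?s l)) \<le> sin (pi * c) ^ n" if l: "l \<in> sample_range M" for l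
  proof -
    define \<theta> where "\<theta> = 2 * pi * real_of_int l * \<epsilon> / 2 ^ R"
    have "cinner (dyadic (int R) (int k) \<phi>) (?s l) = cis (- \<theta>) ^ k * cinner (dyadic (int R) 0 \<phi>) (?s l)"
      if k: "k \<le> n" for k
    proof -
      have "real_of_int (int k + \<lceil>a\<rceil>) \<le> real_of_int (2 ^ R * \<lceil>a\<rceil>)"
        using k_le[OF k] by (simp only: of_int_le_iff)
      moreover have "2 ^ R * real_of_int \<lceil>a\<rceil> \<le> 2 ^ R * T2"
        using T by simp
      ultimately have "real_of_int (int k) + a \<le> 2 ^ R * T2"
        using le_of_int_ceiling[of a] unfolding of_int_add of_int_mult of_int_power of_int_numeral
        by linarith
      then have "cinner (dyadic (int R) (int k) \<phi>) (?s l) =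
          cis (- (2 * pi * real_of_int l * \<epsilon> * (real_of_int (int k) / 2 ^ R))) *
          cinner (dyadic (int R) 0 \<phi>) (?s l)"
        using supp_\<phi> T(1) pos \<epsilon> by (intro cinner_dyadic_sampler) auto
      then show ?thesis
        by (simp add: \<theta>_def Complex.DeMoivre mult.commute)
    qed
    then have "cinner h (?s l) =
        (\<Sum>k\<le>n. \<alpha> k * (cis (- \<theta>) ^ k * cinner (dyadic (int R) 0 \<phi>) (?s l)))"
      unfolding h_def cinner_sum_left cinner_scaleC_left by (intro sum.cong) auto
    also have "\<dots> = (\<Sum>k\<le>n. of_nat (n choose k) * (- cis (- \<theta>)) ^ k * 1 ^ (n - k)) / 2 ^ n
        * cinner (dyadic (int R) 0 \<phi>) (?s l)"
      unfolding sum_divide_distrib sum_distrib_right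
      by (intro sum.cong refl) (simp add: \<alpha>_def power_minus[of "cis _"])
    also have "\<dots> = ((1 - cis (- \<theta>)) / 2) ^ n * cinner (dyadic (int R) 0 \<phi>) (?s l)"
      unfolding binomial_ring[symmetric] by (simp add: power_divide)
    finally have "cmod (cinner h (?s l)) =
        \<bar>sin (\<theta> / 2)\<bar> ^ n * cmod (cinner (dyadic (int R) 0 \<phi>) (?s l))"
      by (simp add: norm_mult norm_power norm_divide cmod_1_minus_cis)
    moreover have "cmod (cinner (dyadic (int R) 0 \<phi>) (?s l)) \<le> 1"
    proof -
      have "(norm (dyadic (int R) 0 \<phi>))\<^sup>2 = 1"
        using cinner_self[of "dyadic (int R) 0 \<phi>"] cinner_dyadic_\<phi>[of "int R" 0 0]
        by (metis of_bool_eq(2) of_real_eq_1_iff)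
      then have "norm (dyadic (int R) 0 \<phi>) = 1"
        by (simp add: power2_eq_1_iff) (smt (verit) norm_ge_zero)
      then show ?thesis
        using cmod_cinner_le[of "dyadic (int R) 0 \<phi>" "?s l"] by (simp add: norm_sampler \<epsilon> pos)
    qed
    moreover have "\<bar>sin (\<theta> / 2)\<bar> \<le> sin (pi * c)"
    proof (rule abs_sin_le_sin)
      \<comment> \<open>The sample range is asymmetric for even \<open>M\<close>, but both of its
        ends obey this bound.\<close>
      have "\<bar>real_of_int l\<bar> \<le> real M / 2"
        using l unfolding sample_range_def by auto linarith+
      then have "pi * \<bar>real_of_int l\<bar> * \<epsilon> / 2 ^ R \<le> pi * (real M / 2) * \<epsilon> / 2 ^ R"
        using \<epsilon> by (intro divide_right_mono mult_right_mono mult_left_mono) auto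
      then have "\<bar>\<theta> / 2\<bar> \<le> pi * (real M / 2) * \<epsilon> / 2 ^ R"
        using \<epsilon>(1) by (simp add: \<theta>_def abs_mult mult.assoc)
      also have "\<dots> = pi * (\<epsilon> * real M / (2 * 2 ^ R))"
        by simp
      also have "\<dots> \<le> pi * c"
        using c(1) by (intro mult_left_mono) auto
      finally show "\<bar>\<theta> / 2\<bar> \<le> pi * c" .
      show "pi * c \<le> pi / 2"
        using c(2) by simp
    qed
    ultimately show ?thesis
      using mult_mono[of "\<bar>sin (\<theta> / 2)\<bar> ^ n" "sin (pi * c) ^ n" "cmod (cinner (dyadic (int R) 0 \<phi>) (?s l))" 1]
        power_mono[of "\<bar>sin (\<theta> / 2)\<bar>" "sin (pi * c)" n] by (simp add: order_trans[OF abs_ge_zero])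
  qed
  have "0 \<le> \<epsilon> * real M / (2 * 2 ^ R)"
    using \<epsilon> by simp
  then have "0 \<le> pi * c" "pi * c \<le> pi"
    using c by auto
  then have "0 \<le> sin (pi * c)"
    by (rule sin_ge_zero)
  then have samples: "samples_norm T1 T2 \<epsilon> M h \<le> sqrt (real M) * sin (pi * c) ^ n"
    using samples_norm_le[OF sample, of M] by simp
  have "1 / (sqrt (2 ^ R) * (sqrt (real M) * sin (pi * c) ^ n)) =
      1 / sqrt (2 ^ R) / (sqrt (real M) * sin (pi * c) ^ n)"
    by simp
  also have "\<dots> \<le> norm h / samples_norm T1 T2 \<epsilon> M h"
    using condition_number_ge(1)[OF F S h_mem h0] norm_h samples by (intro frac_le) auto
  finally show ?thesis
    using condition_number_ge(2)[OF F S h_mem h0] unfolding n_def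
    by (meson ennreal_leI order_trans)
qed

section \<open>Growth of the dimensions and the exponential rate\<close>

lemma filterlim_N_level:
  assumes "a \<ge> 1"
  shows "filterlim (N_level a) at_top sequentially"
  by (rule filterlim_at_top_mono[OF filterlim_ident])
    (intro always_eventually allI less_imp_le N_level_gt assms)

lemma real_N_level:
  assumes "a \<ge> 1"
  shows "real (N_level a R) = 2 ^ R * real_of_int \<lceil>a\<rceil> + (real R + 1) * (real_of_int \<lceil>a\<rceil> - 1)"
proof -
  have "1 \<le> nat \<lceil>a\<rceil>" "real (nat \<lceil>a\<rceil>) = real_of_int \<lceil>a\<rceil>"
    using assms by linarith+
  then show ?thesis
    by (simp only: N_level_def of_nat_add of_nat_mult of_nat_power of_nat_numeral of_nat_diff of_nat_1)
qed

text \<open>The term linear in \<open>R\<close> is negligible against \<open>2 ^ R\<close>. The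
  limit is the source of the factor \<open>\<lceil>a\<rceil>\<close> in the critical ratio.\<close>

lemma N_level_ratio_tendsto:
  assumes "a \<ge> 1"
  shows "(\<lambda>R. real (N_level a R) / 2 ^ R) \<longlonglongrightarrow> real_of_int \<lceil>a\<rceil>"
proof -
  have "(\<lambda>R. real (Suc R) / 2 ^ Suc R :: real) \<longlonglongrightarrow> 0"
    by (rule LIMSEQ_Suc[OF lim_n_over_pown]) simp
  then have "(\<lambda>R. real_of_int \<lceil>a\<rceil> + 2 * (real (Suc R) / 2 ^ Suc R) * (real_of_int \<lceil>a\<rceil> - 1))
      \<longlonglongrightarrow> real_of_int \<lceil>a\<rceil> + 2 * 0 * (real_of_int \<lceil>a\<rceil> - 1)"
    by (intro tendsto_intros)
  moreover have "real (N_level a R) / 2 ^ R =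
      real_of_int \<lceil>a\<rceil> + 2 * (real (Suc R) / 2 ^ Suc R) * (real_of_int \<lceil>a\<rceil> - 1)" for R
    unfolding real_N_level[OF assms] by (simp add: add_divide_distrib distrib_right add.commute)
  ultimately show ?thesis
    by simp
qed

text \<open>This converts the exponent \<open>2 ^ R - 1\<close> into a rate in the dimension. One
  factor 2 absorbs the term linear in \<open>R\<close>, the other the subtracted 1.\<close>

lemma N_level_le:
  assumes "a \<ge> 1" "R \<ge> 1"
  shows "real (N_level a R) \<le> 4 * real_of_int \<lceil>a\<rceil> * real (2 ^ R - 1)"
proof -
  have A: "real_of_int \<lceil>a\<rceil> \<ge> 1"
    using assms by linarith
  have "Suc R \<le> 2 ^ R"
    using less_exp[of R] by (rule Suc_leI)
  then have R: "real R + 1 \<le> 2 ^ R"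
    by (metis of_nat_Suc of_nat_le_iff of_nat_numeral of_nat_power add.commute)
  have "(2::real) ^ 1 \<le> 2 ^ R"
    using assms by (intro power_increasing) auto
  moreover have "real (2 ^ R - 1) = 2 ^ R - 1"
    by (simp add: of_nat_diff)
  ultimately have n: "2 * 2 ^ R \<le> 4 * real (2 ^ R - 1)"
    by simp
  have "(real R + 1) * (real_of_int \<lceil>a\<rceil> - 1) \<le> 2 ^ R * real_of_int \<lceil>a\<rceil>"
    using R A by (intro mult_mono) auto
  then have "real (N_level a R) \<le> real_of_int \<lceil>a\<rceil> * (2 * 2 ^ R)"
    unfolding real_N_level[OF assms(1)] by (simp add: mult.commute)
  also have "\<dots> \<le> real_of_int \<lceil>a\<rceil> * (4 * real (2 ^ R - 1))"
    using n A by (intro mult_left_mono) auto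
  finally show ?thesis
    by (simp add: mult.commute mult.left_commute)
qed

text \<open>Since \<open>N \<le> 4 * A * n\<close>, the quantity \<open>1 / s ^ n\<close> is at
  least the square of \<open>exp (\<rho> * N)\<close> for the chosen \<open>\<rho>\<close>. One
  factor pays for the loss \<open>sqrt q * sqrt m\<close>, which is at most linear in
  \<open>N\<close>; the other is the asserted growth.\<close>

lemma exp_linear_le_inverse_power:
  fixes s \<beta> A m :: real
  assumes s: "0 < s" "s < 1" and pos: "0 < \<beta>" "0 < A" "0 < m"
    and N: "0 < N" "N \<le> 4 * A * real n" and m: "m \<le> \<beta> * N" and q: "0 < q" "q \<le> N"
  shows "- ln s / (8 * A) / sqrt \<beta> * exp (- ln s / (8 * A) * N) \<le> 1 / (sqrt q * (sqrt m * s ^ n))"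
proof -
  define \<rho> where "\<rho> = - ln s / (8 * A)"
  have \<rho>: "0 < \<rho>"
    using s pos ln_less_zero[of s] by (simp add: \<rho>_def divide_neg_pos)
  have "\<rho> * N + \<rho> * N = - ln s * (N / (4 * A))"
    using pos by (simp add: \<rho>_def field_simps)
  also have "\<dots> \<le> - ln s * real n"
    using N s pos by (intro mult_left_mono) (auto simp: divide_le_eq mult.commute)
  finally have "exp (\<rho> * N) * exp (\<rho> * N) \<le> exp (- ln s * real n)"
    by (simp flip: exp_add)
  also have "\<dots> = 1 / s ^ n"
    using s by (simp add: exp_minus exp_of_nat2_mult inverse_eq_divide)
  finally have e: "exp (\<rho> * N) * exp (\<rho> * N) \<le> 1 / s ^ n" .
  have "\<rho> * N \<le> exp (\<rho> * N)"
    using exp_ge_add_one_self[of "\<rho> * N"] by linarith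
  then have "\<rho> * N * exp (\<rho> * N) \<le> exp (\<rho> * N) * exp (\<rho> * N)"
    by (rule mult_right_mono) simp
  also note e
  finally have main: "\<rho> * N * exp (\<rho> * N) \<le> 1 / s ^ n" .
  have "sqrt q * sqrt m \<le> sqrt N * sqrt (\<beta> * N)"
    using q m pos N by (intro mult_mono) auto
  also have "\<dots> = sqrt \<beta> * N"
    using N by (simp add: real_sqrt_mult)
  finally have root: "sqrt q * sqrt m \<le> sqrt \<beta> * N" .
  have "\<rho> / sqrt \<beta> * exp (\<rho> * N) = \<rho> * N * exp (\<rho> * N) / (sqrt \<beta> * N)"
    using N by simp
  also have "\<dots> \<le> (1 / s ^ n) / (sqrt q * sqrt m)"
    using main root q pos \<rho> N by (intro frac_le) (auto simp: s(1) less_imp_le)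
  finally show ?thesis
    by (simp add: \<rho>_def mult_ac)
qed

section \<open>Exponential ill-conditioning below the critical sampling ratio\<close>

theorem theorem4p3:
  fixes \<phi> \<psi> :: L2 and V :: "int \<Rightarrow> L2 set"
    and a T1 T2 \<epsilon> \<eta> :: real
    and \<Theta> :: "nat \<Rightarrow> nat" and G :: "nat \<Rightarrow> L2 \<Rightarrow> L2"
  assumes "MRA V \<phi>" and "associated_wavelet V \<psi>"
    and "a \<ge> 1" and "ess_support \<phi> = {0..a}" and "ess_support \<psi> = {0..a}"
    and "T1 \<ge> real_of_int \<lceil>a\<rceil> - 1" and "T2 \<ge> 2 * real_of_int \<lceil>a\<rceil> - 1"
    and "0 < \<epsilon>" and "\<epsilon> \<le> 1 / (T1 + T2)"
    and "\<And>N. N \<ge> 1 \<Longrightarrow> \<Theta> N \<ge> N"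
    and "\<And>N. N \<ge> 1 \<Longrightarrow> reconstruction_method T1 T2 \<epsilon> (\<Theta> N) (recon_space \<phi> \<psi> a N) (G N)"
    and "\<And>N. N \<ge> 1 \<Longrightarrow> perfect (recon_space \<phi> \<psi> a N) (G N)"
    and "sampling_ratio \<Theta> = ereal \<eta>" and "\<eta> \<ge> 1"
    and "\<eta> < 1 / (\<epsilon> * real_of_int \<lceil>a\<rceil>)"
  shows "(\<forall>B::real. \<exists>N\<ge>1. ennreal B < condition_number T1 T2 \<epsilon> (\<Theta> N) (G N)) \<and>
    (\<exists>K>0. \<exists>\<rho>>0. \<forall>\<^sub>F R in sequentially.
       ennreal (K * exp (\<rho> * real (N_level a R)))
         \<le> condition_number T1 T2 \<epsilon> (\<Theta> (N_level a R)) (G (N_level a R)))"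
proof -
  interpret compact_wavelet V \<phi> \<psi> a
  proof
    show "supported_in {0<..<a} \<phi>" "supported_in {0<..<a} \<psi>"
      using supported_in_ess_support[of \<phi>] supported_in_ess_support[of \<psi>] assms(4,5)
      by (simp_all add: supported_in_interior_Icc)
  qed fact+
  define A where "A = real_of_int \<lceil>a\<rceil>"
  define N where "N = N_level a"
  have A: "1 \<le> A"
    using \<open>a \<ge> 1\<close> by (simp add: A_def)
  have T: "0 \<le> T1" "A \<le> T2"
    using assms(6,7) A unfolding A_def by linarith+
  then have \<epsilon>: "\<epsilon> * (T1 + T2) \<le> 1"
    using assms(9) A by (simp add: le_divide_eq)
  have N1: "N R \<ge> 1" "real (N R) > 0" for R
    using N_level_gt[OF \<open>a \<ge> 1\<close>, of R] by (simp_all add: N_def)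

  \<comment> \<open>The room above \<open>\<eta>\<close> turns the limsup into an eventual linear
    bound on \<open>\<Theta>\<close>; the room below the critical ratio keeps the sampled band away
    from frequency 1/2.\<close>
  obtain \<beta> where \<beta>: "\<eta> < \<beta>" "\<beta> < 1 / (\<epsilon> * A)"
    using dense assms(15) unfolding A_def by blast
  then have \<beta>0: "0 < \<beta>"
    using \<open>\<eta> \<ge> 1\<close> by simp
  have "limsup (\<lambda>N. ereal (real (\<Theta> N) / real N)) < ereal \<beta>"
    using assms(13) \<beta> by (simp add: sampling_ratio_def)
  then have "\<forall>\<^sub>F n in sequentially. ereal (real (\<Theta> n) / real n) < ereal \<beta>"
    by (rule Limsup_lessD)
  then have "\<forall>\<^sub>F R in sequentially. ereal (real (\<Theta> (N R)) / real (N R)) < ereal \<beta>"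
    unfolding N_def by (rule eventually_compose_filterlim[OF _ filterlim_N_level[OF \<open>a \<ge> 1\<close>]])
  then have ratio: "\<forall>\<^sub>F R in sequentially. real (\<Theta> (N R)) \<le> \<beta> * real (N R)"
    by eventually_elim (use N1(2) in \<open>simp add: pos_divide_less_eq less_imp_le\<close>)

  \<comment> \<open>The left side is the limit of the bound on the highest sampled frequency,
    because \<open>N R / 2 ^ R\<close> tends to \<open>A\<close>. A fixed \<open>c\<close> fits
    strictly between.\<close>
  have "\<epsilon> * \<beta> / 2 * A < 1 / 2"
    using \<beta>(2) \<open>0 < \<epsilon>\<close> A by (simp add: less_divide_eq mult.commute mult.left_commute)
  then obtain c where c: "\<epsilon> * \<beta> / 2 * A < c" "c < 1 / 2"
    using dense by blast
  have "0 < \<epsilon> * \<beta> / 2 * A"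
    using \<open>0 < \<epsilon>\<close> \<beta>0 A by simp
  then have c0: "0 < c"
    using c(1) by linarith
  have "(\<lambda>R. \<epsilon> * \<beta> / 2 * (real (N R) / 2 ^ R)) \<longlonglongrightarrow> \<epsilon> * \<beta> / 2 * A"
    unfolding N_def A_def by (intro tendsto_intros N_level_ratio_tendsto \<open>a \<ge> 1\<close>)
  then have "\<forall>\<^sub>F R in sequentially. \<epsilon> * \<beta> / 2 * (real (N R) / 2 ^ R) < c"
    using c(1) by (rule order_tendstoD)
  then have band: "\<forall>\<^sub>F R in sequentially. \<epsilon> * real (\<Theta> (N R)) / (2 * 2 ^ R) \<le> c"
    using ratio
  proof eventually_elim
    case (elim R)
    have "\<epsilon> * real (\<Theta> (N R)) / (2 * 2 ^ R) \<le> \<epsilon> * (\<beta> * real (N R)) / (2 * 2 ^ R)"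
      using elim(2) \<open>0 < \<epsilon>\<close> by (intro divide_right_mono mult_left_mono) auto
    with elim(1) show ?case
      by simp
  qed

  \<comment> \<open>The strict bounds on \<open>c\<close> place \<open>s\<close> strictly between 0
    and 1, so \<open>- ln s\<close> is a positive rate.\<close>
  define s where "s = sin (pi * c)"
  have "0 < pi * c" "pi * c < pi / 2"
    using c c0 by auto
  then have s: "0 < s" "s < 1"
    using sin_gt_zero[of "pi * c"] sin_monotone_2pi[of "pi * c" "pi / 2"] by (auto simp: s_def)
  define \<rho> where "\<rho> = - ln s / (8 * A)"
  define K where "K = \<rho> / sqrt \<beta>"
  have \<rho>: "0 < \<rho>"
    using s A ln_less_zero[of s] by (simp add: \<rho>_def divide_neg_pos)
  then have K: "0 < K"
    using \<beta>0 by (simp add: K_def)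

  have lower: "\<forall>\<^sub>F R in sequentially. ennreal (K * exp (\<rho> * real (N R)))
      \<le> condition_number T1 T2 \<epsilon> (\<Theta> (N R)) (G (N R))"
    using band ratio eventually_ge_at_top[of 1]
  proof eventually_elim
    case (elim R)
    have "(2::real) ^ R \<le> real (N R)"
    proof -
      have "2 ^ R * 1 \<le> 2 ^ R * A" "0 \<le> (real R + 1) * (A - 1)"
        using A by (intro mult_left_mono mult_nonneg_nonneg; simp)+
      then show ?thesis
        unfolding N_def real_N_level[OF \<open>a \<ge> 1\<close>] A_def by linarith
    qed
    moreover have "0 < real (\<Theta> (N R))"
      using assms(10)[OF N1(1)[of R]] N1(1)[of R] by simp
    ultimately have "K * exp (\<rho> * real (N R)) \<le>
        1 / (sqrt (2 ^ R) * (sqrt (real (\<Theta> (N R))) * s ^ (2 ^ R - 1)))"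
      unfolding K_def \<rho>_def using s \<beta>0 A N1(2) elim N_level_le[OF \<open>a \<ge> 1\<close>, of R]
      by (intro exp_linear_le_inverse_power) (auto simp: N_def A_def)
    then have "ennreal (K * exp (\<rho> * real (N R))) \<le>
        ennreal (1 / (sqrt (2 ^ R) * (sqrt (real (\<Theta> (N R))) * s ^ (2 ^ R - 1))))"
      by (rule ennreal_leI)
    also have "\<dots> \<le> condition_number T1 T2 \<epsilon> (\<Theta> (N R)) (G (N R))"
      unfolding s_def using elim(1) c(2) T \<epsilon> assms(3,8) N1(1)[of R] assms(11,12)
      by (intro condition_number_level_ge) (auto simp: N_def A_def)
    finally show ?case .
  qed

  have unbounded: "\<exists>n\<ge>1. ennreal B < condition_number T1 T2 \<epsilon> (\<Theta> n) (G n)" for B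
  proof -
    have "filterlim (\<lambda>R. real (N R)) at_top sequentially"
      unfolding N_def
      by (rule filterlim_compose[OF filterlim_real_sequentially filterlim_N_level[OF \<open>a \<ge> 1\<close>]])
    \<comment> \<open>From this threshold on, even the linear minorant
      \<open>K * \<rho> * N R\<close> of the exponential bound reaches
      \<open>\<bar>B\<bar>\<close>.\<close>
    then have "\<forall>\<^sub>F R in sequentially. \<bar>B\<bar> / (K * \<rho>) \<le> real (N R)"
      by (simp add: filterlim_at_top)
    then have "\<forall>\<^sub>F R in sequentially. ennreal B < condition_number T1 T2 \<epsilon> (\<Theta> (N R)) (G (N R))"
      using lower
    proof eventually_elim
      case (elim R)
      have exp_gt: "\<rho> * real (N R) < exp (\<rho> * real (N R))"
        using exp_ge_add_one_self[of "\<rho> * real (N R)"] by linarith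
      have "\<bar>B\<bar> \<le> K * (\<rho> * real (N R))"
        using elim(1) K \<rho> by (simp add: divide_le_eq mult_ac)
      also have "\<dots> < K * exp (\<rho> * real (N R))"
        using exp_gt K by (rule mult_strict_left_mono)
      finally have "ennreal B < ennreal (K * exp (\<rho> * real (N R)))"
        using K by (intro ennreal_lessI) auto
      then show ?case
        using elim(2) by (rule order.strict_trans2)
    qed
    then obtain R where "ennreal B < condition_number T1 T2 \<epsilon> (\<Theta> (N R)) (G (N R))"
      by (auto simp: eventually_sequentially)
    then show ?thesis
      using N1(1) by blast
  qed
  show ?thesis
    using unbounded lower K \<rho> unfolding N_def by blast
qed

end
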